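(* (i) Let $\Omega\subset\mathbb C$ be an arbitrary bounded open set. Then the set of $g\in\bigcap_{p<2}\mathcal{O}L^p(\Omega)$ which are totally unbounded in $\Omega$ is dense and $G_\delta$ in $\bigcap_{p<2}\mathcal{O}L^p(\Omega)$. (ii) Let $\Omega\subset\mathbb C$ be a bounded open set such that for every $\zeta\in\partial\Omega$ the connected component $C_\zeta$ of $\mathbb C\setminus\Omega$ containing $\zeta$ satisfies $C_\zeta\setminus\{\zeta\}\ne\emptyset$. Then for each $q$ with $1<q<\infty$, the set of $g\in\bigcap_{p<q}\mathcal{O}L^p(\Omega)$ which are totally unbounded in $\Omega$ is dense and $G_\delta$ in $\bigcap_{p<q}\mathcal{O}L^p(\Omega)$. (iii) Let $\Omega\subset\mathbb C$ be a bounded open set with $C^1$ boundary and $1<q\le\infty$. Then the set $$\Big\{g\in\bigcap_{p<q}\mathcal{O}L^p(\Omega): g\text{ totally unbounded in }\Omega,\ g\notin\mathcal{O}L^q(B(\zeta,\varepsilon)\cap\Omega)\ \forall\zeta\in\partial\Omega,\ \forall\varepsilon>0\Big\}$$ is dense and $G_\delta$ in $\bigcap_{p<q}\mathcal{O}L^p(\Omega)$.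
   Context: For an open bounded set $D$ and $p\ge1$, $\mathcal{O}L^p(D)$ is the space of holomorphic $f$ on $D$ with $\int_D|f|^p\,dv<\infty$; $\mathcal{O}L^\infty(D)$ is the space of bounded holomorphic functions. For $1<q\le\infty$, $\bigcap_{p<q}\mathcal{O}L^p(\Omega)$ carries the complete metric $d(f,g)=\sum_j2^{-j}\frac{\|f-g\|_{p_j}}{1+\|f-g\|_{p_j}}$ with $1<p_1<p_2<\dots$, $p_j\to q$; convergence means $\|f_k-f\|_p\to0$ for all $p<q$. A holomorphic $f$ is totally unbounded in $\Omega$ if for every $w\in\partial\Omega$, $\delta>0$ and every connected component $E$ of $B(w,\delta)\cap\Omega$, $\sup_E|f|=\infty$. *)

theory Defs
  imports "HOL-Analysis.Analysis"
begin

definition lp_integral :: "real \<Rightarrow> complex set \<Rightarrow> (complex \<Rightarrow> complex) \<Rightarrow> ennreal" where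
  "lp_integral p D f = (\<integral>\<^sup>+ z. ennreal (cmod (f z) powr p) * indicator D z \<partial>lborel)"

definition OLp :: "ereal \<Rightarrow> complex set \<Rightarrow> (complex \<Rightarrow> complex) set" where
  "OLp q D = {f. f holomorphic_on D \<and>
     (if q = \<infinity> then bounded (f ` D) else lp_integral (real_of_ereal q) D f < \<infinity>)}"

definition lp_norm :: "real \<Rightarrow> complex set \<Rightarrow> (complex \<Rightarrow> complex) \<Rightarrow> real" where
  "lp_norm p D f = (enn2real (lp_integral p D f)) powr (1 / p)"

text \<open>The space bigcap_{p<q} OL^p(Omega). Functions are represented by their zero extension
  outside Omega, so that elements of the space correspond one-to-one to holomorphic functions
  on Omega.\<close>
definition OLbelow :: "ereal \<Rightarrow> complex set \<Rightarrow> (complex \<Rightarrow> complex) set" where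
  "OLbelow q \<Omega> = {f. f holomorphic_on \<Omega> \<and> (\<forall>z. z \<notin> \<Omega> \<longrightarrow> f z = 0) \<and>
     (\<forall>p::real. 1 \<le> p \<and> ereal p < q \<longrightarrow> f \<in> OLp (ereal p) \<Omega>)}"

text \<open>Admissible exponent sequences: 1 < p_1 < p_2 < ..., p_j \<rightarrow> q (indexed from 0 here).\<close>
definition admissible_seq :: "ereal \<Rightarrow> (nat \<Rightarrow> real) \<Rightarrow> bool" where
  "admissible_seq q p \<longleftrightarrow> 1 < p 0 \<and> (\<forall>j. p j < p (Suc j)) \<and> ((\<lambda>j. ereal (p j)) \<longlonglongrightarrow> q)"

definition OLdist :: "complex set \<Rightarrow> (nat \<Rightarrow> real) \<Rightarrow> (complex \<Rightarrow> complex) \<Rightarrow> (complex \<Rightarrow> complex) \<Rightarrow> real" where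
  "OLdist \<Omega> p f g = (\<Sum>j. (1/2) ^ Suc j * (lp_norm (p j) \<Omega> (\<lambda>z. f z - g z) /
                                          (1 + lp_norm (p j) \<Omega> (\<lambda>z. f z - g z))))"

definition ms_open :: "'a set \<Rightarrow> ('a \<Rightarrow> 'a \<Rightarrow> real) \<Rightarrow> 'a set \<Rightarrow> bool" where
  "ms_open X d U \<longleftrightarrow> U \<subseteq> X \<and> (\<forall>f\<in>U. \<exists>e>0. \<forall>g\<in>X. d f g < e \<longrightarrow> g \<in> U)"

definition ms_dense :: "'a set \<Rightarrow> ('a \<Rightarrow> 'a \<Rightarrow> real) \<Rightarrow> 'a set \<Rightarrow> bool" where
  "ms_dense X d A \<longleftrightarrow> A \<subseteq> X \<and> (\<forall>f\<in>X. \<forall>e>0. \<exists>g\<in>A. d f g < e)"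

definition ms_gdelta :: "'a set \<Rightarrow> ('a \<Rightarrow> 'a \<Rightarrow> real) \<Rightarrow> 'a set \<Rightarrow> bool" where
  "ms_gdelta X d A \<longleftrightarrow> (\<exists>U :: nat \<Rightarrow> 'a set. (\<forall>n. ms_open X d (U n)) \<and> A = (\<Inter>n. U n))"

definition totally_unbounded :: "(complex \<Rightarrow> complex) \<Rightarrow> complex set \<Rightarrow> bool" where
  "totally_unbounded f \<Omega> \<longleftrightarrow>
     (\<forall>w\<in>frontier \<Omega>. \<forall>\<delta>>0. \<forall>x\<in>ball w \<delta> \<inter> \<Omega>.
        \<not> bounded (f ` connected_component_set (ball w \<delta> \<inter> \<Omega>) x))"

definition C1_boundary :: "complex set \<Rightarrow> bool" where
  "C1_boundary \<Omega> \<longleftrightarrow>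
     (\<forall>\<zeta>\<in>frontier \<Omega>. \<exists>U \<rho> (grad :: complex \<Rightarrow> complex).
        open U \<and> \<zeta> \<in> U \<and>
        (\<forall>z\<in>U. (\<rho> has_derivative (\<lambda>h. grad z \<bullet> h)) (at z)) \<and>
        continuous_on U grad \<and> (\<forall>z\<in>U. grad z \<noteq> 0) \<and>
        \<Omega> \<inter> U = {z\<in>U. (\<rho> z :: real) < 0})"

end

theory Submission
  imports Defs "HOL-Complex_Analysis.Complex_Analysis"
begin

text \<open>The space of functions in question is a complete metric space, since \<open>L\<^sup>p\<close> convergence of holomorphic
  functions implies locally uniform convergence. Total unboundedness, and non-integrability near
  every boundary point, each amount to countably many conditions of the form
  \<open>\<Phi> g = \<infinity>\<close>, where \<open>\<Phi>\<close> is lower semicontinuous and finite on a linear subspace only; by Baire's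
  theorem it is enough to find one function with \<open>\<Phi> h = \<infinity>\<close> for each condition. Near a boundary
  point \<open>\<zeta>\<close> these are \<open>1 / (z - \<zeta>)\<close> in (i), and a branch of \<open>((z - \<zeta>) / (z - a)) powr (- 2 / q)\<close> in
  (ii) and in (iii) for finite \<open>q\<close>, where \<open>a\<close> lies in the same component of the complement as \<open>\<zeta>\<close>: the
  logarithm may have unbounded imaginary part, but the modulus of a real power does not depend on
  it. In (iii) with \<open>q = \<infinity>\<close> the principal logarithm of \<open>(z - \<zeta>) / (z - a)\<close> works, with \<open>a\<close> on the
  outer normal at \<open>\<zeta>\<close>.\<close>

section \<open>Powers of the distance to a point\<close>

text \<open>Total unboundedness quantifies over uncountably many balls, and over components that
  vary with the ball, whereas Baire's theorem needs countably many conditions. Components of open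
  sets are open, so a countable dense set can supply both the centres and the labels of components.
  A ball off the boundary does no harm: if it is not contained in \<Omega>, each component of its
  intersection with \<Omega> accumulates at a boundary point inside the ball, and a function whose
  modulus tends to infinity there is unbounded on that component. So one function per boundary point
  serves all components. The exponent 2 / q is critical in the plane: a modulus comparable to |z -
  \<zeta>| to the power - 2 / q is in all L^p with p < q, and fails for p = q where \<Omega>
  contains a cone at \<zeta>. For q = 2 this is a simple pole, which is single-valued; hence (i)
  asks nothing of the complement. In (ii) \<Omega> may be multiply connected, yet the quotient has a
  logarithm because every loop in \<Omega> winds equally often around \<zeta> and a.\<close>

lemma emeasure_ball_complex:
  fixes c :: complex
  assumes "r \<ge> 0"
  shows "emeasure lborel (ball c r) = ennreal (pi * r\<^sup>2)"
  using assms by (simp add: emeasure_ball eval_unit_ball_vol)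

text \<open>Dyadic shells around \<open>\<zeta>\<close>: where the distance is about
  \<open>R / 2 ^ n\<close> the integrand is at most \<open>c n\<close> and the area is of order
  \<open>(1/4) ^ n\<close>. The total is a geometric series with ratio
  \<open>2 powr \<beta> / 4\<close>, which is below 1 because \<open>\<beta> < 2\<close>.\<close>

lemma nn_integral_norm_powr_finite:
  fixes \<zeta> :: complex
  assumes \<beta>: "0 < \<beta>" "\<beta> < 2" and D: "bounded D"
  shows "(\<integral>\<^sup>+z. ennreal (cmod (z - \<zeta>) powr - \<beta>) * indicator D z \<partial>lborel) < \<infinity>"
proof -
  obtain R where R: "R > 0" "D \<subseteq> ball \<zeta> R"
    using D bounded_subset_ballD[of D \<zeta>] by auto
  define c where "c n = (R / 2 ^ Suc n) powr - \<beta>" for n :: nat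
  \<comment> \<open>Whole balls replace the shells; this costs a constant factor and needs no areas
    but those of balls. At \<open>z = \<zeta>\<close> the left side is 0, because
    \<open>0 powr - \<beta> = 0\<close>.\<close>
  have pointwise: "ennreal (cmod (z - \<zeta>) powr - \<beta>) * indicator D z
      \<le> (\<Sum>n. ennreal (c n) * indicator (ball \<zeta> (R / 2 ^ n)) z)" for z
  proof (cases "z \<in> D \<and> z \<noteq> \<zeta>")
    case True
    define x where "x = cmod (z - \<zeta>)"
    have x: "0 < x" "x < R"
      using True R by (auto simp: x_def dist_norm norm_minus_commute subset_iff)
    obtain m where "R / 2 ^ m \<le> x"
    proof -
      obtain m where "(1/2) ^ m < x / R"
        using real_arch_pow_inv[of "x / R" "1/2"] x R by auto
      then have "R / 2 ^ m \<le> x"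
        using R by (simp add: field_simps)
      then show ?thesis using that by blast
    qed
    define n where "n = (LEAST n. R / 2 ^ Suc n \<le> x)"
    have "R / 2 ^ Suc m \<le> R / 2 ^ m"
      using R by (simp add: field_simps)
    with \<open>R / 2 ^ m \<le> x\<close> have n1: "R / 2 ^ Suc n \<le> x"
      unfolding n_def by (intro LeastI[of "\<lambda>n. R / 2 ^ Suc n \<le> x" m]) linarith
    have n2: "x < R / 2 ^ n"
    proof (cases n)
      case (Suc k)
      then have "\<not> R / 2 ^ Suc k \<le> x"
        using not_less_Least[of k "\<lambda>n. R / 2 ^ Suc n \<le> x"] n_def by auto
      then show ?thesis using Suc by simp
    qed (use x in simp)
    have "x powr - \<beta> \<le> c n"
      unfolding c_def using n1 R \<beta> by (intro powr_mono2') auto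
    then have "ennreal (cmod (z - \<zeta>) powr - \<beta>) * indicator D z \<le>
        ennreal (c n) * indicator (ball \<zeta> (R / 2 ^ n)) z"
      using True n2 by (auto simp: x_def dist_norm norm_minus_commute ennreal_leI)
    also have "\<dots> \<le> (\<Sum>n. ennreal (c n) * indicator (ball \<zeta> (R / 2 ^ n)) z)"
    proof -
      have "F n \<le> (\<Sum>n. F n)" for F :: "nat \<Rightarrow> ennreal"
        using sum_le_suminf[of F "{n}"] by simp
      then show ?thesis .
    qed
    finally show ?thesis .
  qed auto
  have "(\<integral>\<^sup>+z. ennreal (cmod (z - \<zeta>) powr - \<beta>) * indicator D z \<partial>lborel)
      \<le> (\<integral>\<^sup>+z. (\<Sum>n. ennreal (c n) * indicator (ball \<zeta> (R / 2 ^ n)) z) \<partial>lborel)"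
    by (intro nn_integral_mono pointwise)
  also have "\<dots> = (\<Sum>n. (\<integral>\<^sup>+z. ennreal (c n) * indicator (ball \<zeta> (R / 2 ^ n)) z \<partial>lborel))"
    by (intro nn_integral_suminf borel_measurable_times_ennreal borel_measurable_const
        borel_measurable_indicator) simp
  also have "\<dots> = (\<Sum>n. ennreal (c n) * ennreal (pi * (R / 2 ^ n)\<^sup>2))"
    using R by (subst nn_integral_cmult_indicator) (auto simp: emeasure_ball_complex)
  also have "\<dots> = (\<Sum>n. ennreal (((R/2) powr - \<beta> * pi * R\<^sup>2) * (2 powr \<beta> / 4) ^ n))"
  proof -
    have "c n * (pi * (R / 2 ^ n)\<^sup>2) = ((R/2) powr - \<beta> * pi * R\<^sup>2) * (2 powr \<beta> / 4) ^ n" for n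
    proof -
      have "c n = (R/2) powr - \<beta> * (2 powr \<beta>) ^ n"
      proof -
        have "((2::real) ^ n) powr \<beta> = (2 powr \<beta>) ^ n"
          by (simp add: powr_powr powr_power mult.commute flip: powr_realpow)
        moreover have "c n = ((R/2) / 2 ^ n) powr - \<beta>"
          by (simp add: c_def)
        moreover have "((R/2) / 2 ^ n) powr - \<beta> = (R/2) powr - \<beta> / (2 ^ n) powr - \<beta>"
          by (rule powr_divide)
        moreover have "(R/2) powr - \<beta> / (2 ^ n) powr - \<beta> = (R/2) powr - \<beta> * (2 ^ n) powr \<beta>"
          unfolding powr_minus[of "2 ^ n"] divide_inverse inverse_inverse_eq ..
        ultimately show ?thesis by simp
      qed
      moreover have "(4::real) ^ n = (2 ^ n)\<^sup>2"
        by (simp add: power2_eq_square flip: power_mult_distrib)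
      ultimately show ?thesis
        by (simp add: power_divide)
    qed
    then have "ennreal (c n) * ennreal (pi * (R / 2 ^ n)\<^sup>2)
        = ennreal (((R/2) powr - \<beta> * pi * R\<^sup>2) * (2 powr \<beta> / 4) ^ n)" for n
      by (metis c_def ennreal_mult' powr_ge_zero)
    then show ?thesis by simp
  qed
  also have "\<dots> < \<infinity>"
  proof -
    have "2 powr \<beta> < 2 powr (2::real)"
      using \<beta> by (intro powr_less_mono) auto
    then have "summable (\<lambda>n. ((R/2) powr - \<beta> * pi * R\<^sup>2) * (2 powr \<beta> / 4) ^ n)"
      by (intro summable_mult summable_geometric) auto
    then show ?thesis
      using R by (subst suminf_ennreal2) auto
  qed
  finally show ?thesis .
qed

text \<open>Along the axis of the cone the balls with heights \<open>s n\<close> have area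
  proportional to the square of \<open>s n\<close>, while the integrand is at least
  \<open>(2 * s n) powr - 2\<close> on them. By this scaling each contributes the same amount
  \<open>pi * \<eta>\<^sup>2 / 4\<close>. They are disjoint because their distances from
  \<open>\<zeta>\<close> lie strictly between \<open>3/4 * s n\<close> and \<open>5/4 * s n\<close>,
  and the heights halve.\<close>

lemma nn_integral_norm_powr_cone_infinite:
  fixes \<zeta> u :: complex
  assumes u: "cmod u = 1" and \<eta>: "0 < \<eta>" "\<eta> \<le> 1/4" and r0: "0 < r0"
    and cone: "\<And>s. 0 < s \<Longrightarrow> s < r0 \<Longrightarrow> ball (\<zeta> + of_real s * u) (\<eta> * s) \<subseteq> D"
  shows "(\<integral>\<^sup>+z. ennreal (cmod (z - \<zeta>) powr - 2) * indicator D z \<partial>lborel) = \<infinity>"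
proof -
  define s where "s n = r0 / 2 ^ Suc n" for n :: nat
  have s: "0 < s n" "s n < r0" for n
  proof -
    have "(1::real) < 2 ^ Suc n"
      by (rule one_less_power) auto
    then show "0 < s n" "s n < r0"
      using r0 by (auto simp: s_def field_simps)
  qed
  define B where "B n = ball (\<zeta> + of_real (s n) * u) (\<eta> * s n)" for n
  have B: "3/4 * s n < cmod (z - \<zeta>)" "cmod (z - \<zeta>) < 5/4 * s n" if "z \<in> B n" for z n
  proof -
    have "cmod (z - (\<zeta> + of_real (s n) * u)) < \<eta> * s n"
      using that by (simp add: B_def dist_norm norm_minus_commute)
    also have "\<dots> \<le> 1/4 * s n"
      using \<eta> s[of n] by (intro mult_right_mono) auto
    finally have *: "cmod ((z - \<zeta>) - of_real (s n) * u) < 1/4 * s n"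
      by (simp add: algebra_simps)
    have "cmod (of_real (s n) * u) = s n"
      using u s[of n] by (simp add: norm_mult)
    with * norm_triangle_ineq2[of "z - \<zeta>" "of_real (s n) * u"]
      norm_triangle_ineq2[of "of_real (s n) * u" "z - \<zeta>"]
    show "3/4 * s n < cmod (z - \<zeta>)" "cmod (z - \<zeta>) < 5/4 * s n"
      by (auto simp: norm_minus_commute)
  qed
  have disj: "B m \<inter> B n = {}" if "m < n" for m n
  proof -
    have "s n \<le> s m / 2"
    proof -
      have "(2::real) ^ Suc m \<le> 2 ^ n"
        using that by (intro power_increasing) auto
      then have "2 * 2 ^ m * r0 \<le> r0 * 2 ^ n"
        using r0 by simp
      then show ?thesis
        by (simp add: s_def field_simps)
    qed
    with s[of n] have "5/4 * s n < 3/4 * s m" by simp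
    then show ?thesis using B[of _ m] B[of _ n] by fastforce
  qed
  have "disjoint_family B"
    unfolding disjoint_family_on_def
  proof (intro ballI impI)
    fix m n :: nat assume "m \<noteq> n"
    then consider "m < n" | "n < m" by linarith
    then show "B m \<inter> B n = {}"
      using disj by cases blast+
  qed
  have pointwise: "(\<Sum>n. ennreal ((2 * s n) powr - 2) * indicator (B n) z)
      \<le> ennreal (cmod (z - \<zeta>) powr - 2) * indicator D z" for z
  proof (cases "\<exists>n. z \<in> B n")
    case True
    then obtain n where n: "z \<in> B n" by blast
    then have "z \<in> D" using cone[of "s n"] s[of n] by (auto simp: B_def)
    have "(2 * s n) powr - 2 \<le> cmod (z - \<zeta>) powr - 2"
      using B[OF n] s[of n] by (intro powr_mono2') auto
    then show ?thesis
      using \<open>z \<in> D\<close> suminf_cmult_indicator[OF \<open>disjoint_family B\<close> n, of "\<lambda>n. ennreal ((2 * s n) powr - 2)"]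
      by (simp add: ennreal_leI)
  qed auto
  have "(\<Sum>n. (\<integral>\<^sup>+z. ennreal ((2 * s n) powr - 2) * indicator (B n) z \<partial>lborel))
      = (\<integral>\<^sup>+z. (\<Sum>n. ennreal ((2 * s n) powr - 2) * indicator (B n) z) \<partial>lborel)"
    by (intro nn_integral_suminf[symmetric] borel_measurable_times_ennreal borel_measurable_const
        borel_measurable_indicator) (simp add: B_def)
  also have "\<dots> \<le> (\<integral>\<^sup>+z. ennreal (cmod (z - \<zeta>) powr - 2) * indicator D z \<partial>lborel)"
    by (intro nn_integral_mono pointwise)
  also have "(\<Sum>n. (\<integral>\<^sup>+z. ennreal ((2 * s n) powr - 2) * indicator (B n) z \<partial>lborel))
      = (\<Sum>n. ennreal (pi * \<eta>\<^sup>2 / 4))"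
  proof (intro suminf_cong)
    fix n
    have "(2 * s n) powr - 2 * (pi * (\<eta> * s n)\<^sup>2) = pi * \<eta>\<^sup>2 / 4"
      using s[of n] by (simp add: powr_minus power2_eq_square field_simps)
    then show "(\<integral>\<^sup>+z. ennreal ((2 * s n) powr - 2) * indicator (B n) z \<partial>lborel) = ennreal (pi * \<eta>\<^sup>2 / 4)"
      using \<eta> s[of n]
      by (subst nn_integral_cmult_indicator)
        (auto simp: B_def emeasure_ball_complex less_imp_le simp flip: ennreal_mult)
  qed
  also have "\<dots> = \<infinity>"
  proof (rule ccontr)
    assume "\<not> ?thesis"
    then have "summable (\<lambda>n::nat. pi * \<eta>\<^sup>2 / 4)"
      by (intro summable_suminf_not_top) auto
    then show False using \<eta> by (simp add: summable_const_iff)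
  qed
  finally show ?thesis by (simp add: top_unique)
qed

section \<open>Pointwise bounds for holomorphic functions\<close>

lemma nn_integral_lborel_shift:
  fixes g :: "'a::euclidean_space \<Rightarrow> ennreal"
  assumes "g \<in> borel_measurable borel"
  shows "(\<integral>\<^sup>+a. g (a + c) \<partial>lborel) = (\<integral>\<^sup>+a. g a \<partial>lborel)"
proof -
  have "(\<integral>\<^sup>+a. g a \<partial>lborel) = (\<integral>\<^sup>+a. g a \<partial>distr lborel borel ((+) c))"
    by (simp add: lborel_distr_plus)
  also have "\<dots> = (\<integral>\<^sup>+a. g (c + a) \<partial>lborel)"
    using assms by (subst nn_integral_distr) auto
  finally show ?thesis by (simp add: add.commute)
qed

lemma borel_measurable_holomorphic_extension:
  assumes "open \<Omega>" "f holomorphic_on \<Omega>" "\<And>z. z \<notin> \<Omega> \<Longrightarrow> f z = 0"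
  shows "f \<in> borel_measurable borel"
proof -
  have "(\<lambda>z. if z \<in> \<Omega> then f z else 0) \<in> borel_measurable borel"
    using assms
    by (intro borel_measurable_continuous_on_if holomorphic_on_imp_continuous_on continuous_on_const) auto
  also have "(\<lambda>z. if z \<in> \<Omega> then f z else 0) = f"
    using assms(3) by auto
  finally show ?thesis .
qed

text \<open>Cauchy's formula with the pole off centre: the denominator stays above
  \<open>r / 2\<close> on the circle, which accounts for the factor 2. The pole has to be off centre
  because \<open>z\<close> will stay fixed while the centre \<open>a\<close> is averaged over a
  ball.\<close>

lemma norm_le_circle_mean_off_center:
  fixes f :: "complex \<Rightarrow> complex"
  assumes hol: "f holomorphic_on cball a r" and z: "cmod (z - a) \<le> r / 2" and r: "0 < r"
  shows "ennreal (cmod (f z)) \<le>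
    2 * (\<integral>\<^sup>+t. ennreal (cmod (f (circlepath a r t))) * indicator {0..1} t \<partial>lborel)"
proof -
  define e where "e t = exp (2 * of_real pi * \<i> * of_real t)" for t :: real
  define g where "g t = f (circlepath a r t) / (circlepath a r t - z) * (2 * pi * \<i> * r * e t)" for t :: real
  have e: "cmod (e t) = 1" for t
    by (simp add: e_def)
  have circ: "circlepath a r t = a + r * e t" for t
    by (simp add: circlepath e_def)
  have incb: "circlepath a r t \<in> cball a r" for t
    using r e[of t] by (simp add: circ dist_norm norm_mult)
  have "((\<lambda>u. f u / (u - z)) has_contour_integral (2 * of_real pi * \<i> * f z)) (circlepath a r)"
    using hol z r by (intro Cauchy_integral_circlepath_simple) auto
  then have g_int: "(g has_integral (2 * of_real pi * \<i> * f z)) {0..1}"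
    unfolding has_contour_integral_def
    by (rule has_integral_eq[rotated]) (simp add: g_def e_def vector_derivative_circlepath01)
  have far: "r / 2 \<le> cmod (circlepath a r t - z)" for t
  proof -
    have "cmod (a - z + r * e t) \<ge> cmod (r * e t) - cmod (a - z)"
      by (metis add.commute norm_diff_ineq)
    then show ?thesis
      using z r e[of t] by (simp add: circ norm_mult norm_minus_commute algebra_simps)
  qed
  have g_le: "cmod (g t) \<le> 4 * pi * cmod (f (circlepath a r t))" for t
  proof -
    have "cmod (g t) = cmod (f (circlepath a r t)) * (2 * pi * r) / cmod (circlepath a r t - z)"
      using r e[of t] by (simp add: g_def norm_mult norm_divide)
    also have "\<dots> \<le> cmod (f (circlepath a r t)) * (2 * pi * r) / (r / 2)"
      using far[of t] r by (intro divide_left_mono) (auto intro!: mult_pos_pos)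
    finally show ?thesis using r by (simp add: field_simps)
  qed
  have cont: "continuous_on {0..1} (\<lambda>t. cmod (f (circlepath a r t)))"
    using incb
    by (intro continuous_on_norm continuous_on_compose2[OF holomorphic_on_imp_continuous_on[OF hol]])
      (auto simp: circ e_def intro!: continuous_intros)
  define I where "I = integral {0..1} (\<lambda>t. cmod (f (circlepath a r t)))"
  have I: "((\<lambda>t. cmod (f (circlepath a r t))) has_integral I) {0..1}"
    unfolding I_def by (intro integrable_integral integrable_continuous_real cont)
  have "cmod (2 * of_real pi * \<i> * f z) \<le> 4 * pi * I"
  proof -
    have "norm (integral {0..1} g) \<le> integral {0..1} (\<lambda>t. 4 * pi * cmod (f (circlepath a r t)))"
      using g_int I has_integral_mult_right[OF I, of "4 * pi"] g_le
      by (intro integral_norm_bound_integral) (auto simp: integrable_on_def)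
    then show ?thesis
      using g_int has_integral_mult_right[OF I, of "4 * pi"] by (simp add: integral_unique I_def)
  qed
  then have "cmod (f z) \<le> 2 * I"
    by (simp add: norm_mult)
  moreover have "(\<integral>\<^sup>+t. ennreal (cmod (f (circlepath a r t))) * indicator {0..1} t \<partial>lborel) = ennreal I"
    using nn_integral_has_integral_lebesgue[OF _ I]
    by (simp add: ennreal_mult ennreal_indicator mult.commute)
  moreover have "I \<ge> 0"
    using has_integral_nonneg[OF I] by auto
  ultimately show ?thesis
    by (simp add: ennreal_mult[symmetric] flip: ennreal_numeral)
qed

text \<open>Averaging Cauchy's formula over circles of a fixed radius with variable centre needs only
  the translation invariance of Lebesgue measure, and no polar coordinates.\<close>
lemma norm_le_area_mean:
  fixes f :: "complex \<Rightarrow> complex"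
  assumes hol: "f holomorphic_on ball z (2 * r)" and r: "0 < r"
  shows "ennreal (cmod (f z)) * ennreal (pi * (r / 2)\<^sup>2) \<le>
    2 * (\<integral>\<^sup>+w. ennreal (cmod (f w)) * indicator (ball z (2 * r)) w \<partial>lborel)"
proof -
  define G where "G w = ennreal (cmod (f w)) * indicator (ball z (2 * r)) w" for w
  define F where "F = (\<lambda>w. if w \<in> ball z (2 * r) then f w else 0)"
  have "F holomorphic_on ball z (2 * r)"
    using hol by (rule holomorphic_transform) (simp add: F_def)
  then have "F \<in> borel_measurable borel"
    by (intro borel_measurable_holomorphic_extension[of "ball z (2 * r)"]) (auto simp: F_def)
  moreover have "G = (\<lambda>w. ennreal (cmod (F w)))"
    by (auto simp: G_def F_def fun_eq_iff)
  ultimately have G[measurable]: "G \<in> borel_measurable borel"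
    by simp
  define e where "e t = of_real r * exp (2 * of_real pi * \<i> * of_real t)" for t :: real
  have e[measurable]: "e \<in> borel_measurable borel"
    unfolding e_def by (intro borel_measurable_continuous_onI continuous_intros)
  have sub: "cball a r \<subseteq> ball z (2 * r)" if "a \<in> ball z (r / 2)" for a
  proof
    fix w assume "w \<in> cball a r"
    then show "w \<in> ball z (2 * r)"
      using that dist_triangle[of z w a] r by auto
  qed
  have mean: "ennreal (cmod (f z)) \<le> 2 * (\<integral>\<^sup>+t. G (a + e t) * indicator {0..1} t \<partial>lborel)"
    if a: "a \<in> ball z (r / 2)" for a
  proof -
    have "cmod (z - a) \<le> r / 2"
      using a by (auto simp: dist_norm)
    then have "ennreal (cmod (f z)) \<le>
      2 * (\<integral>\<^sup>+t. ennreal (cmod (f (circlepath a r t))) * indicator {0..1} t \<partial>lborel)"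
      using holomorphic_on_subset[OF hol sub[OF a]] r by (intro norm_le_circle_mean_off_center)
    also have "(\<lambda>t. ennreal (cmod (f (circlepath a r t)))) = (\<lambda>t. G (a + e t))"
    proof
      fix t
      have "a + e t \<in> cball a r"
        using r by (simp add: e_def dist_norm norm_mult)
      then have "a + e t \<in> ball z (2 * r)"
        using sub[OF a] by blast
      moreover have "circlepath a r t = a + e t"
        by (simp add: circlepath e_def)
      ultimately show "ennreal (cmod (f (circlepath a r t))) = G (a + e t)"
        by (simp add: G_def)
    qed
    finally show ?thesis .
  qed
  have "ennreal (cmod (f z)) * ennreal (pi * (r / 2)\<^sup>2)
      = (\<integral>\<^sup>+a. ennreal (cmod (f z)) * indicator (ball z (r / 2)) a \<partial>lborel)"
    using r by (subst nn_integral_cmult_indicator) (auto simp: emeasure_ball_complex)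
  \<comment> \<open>On the right \<open>a\<close> runs through the whole plane, which only enlarges
    the integral. After exchanging the integrals, the shift by \<open>e t\<close> drops out of the
    inner one, so the average over \<open>t\<close> has no effect.\<close>
  also have "\<dots> \<le> (\<integral>\<^sup>+a. 2 * (\<integral>\<^sup>+t. G (a + e t) * indicator {0..1} t \<partial>lborel) \<partial>lborel)"
  proof (intro nn_integral_mono)
    fix a
    show "ennreal (cmod (f z)) * indicator (ball z (r / 2)) a
        \<le> 2 * (\<integral>\<^sup>+t. G (a + e t) * indicator {0..1} t \<partial>lborel)"
      using mean[of a] by (cases "a \<in> ball z (r / 2)") (simp_all del: mem_ball)
  qed
  also have "\<dots> = 2 * (\<integral>\<^sup>+a. (\<integral>\<^sup>+t. G (a + e t) * indicator {0..1} t \<partial>lborel) \<partial>lborel)"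
    by (intro nn_integral_cmult) measurable
  also have "(\<integral>\<^sup>+a. (\<integral>\<^sup>+t. G (a + e t) * indicator {0..1::real} t \<partial>lborel) \<partial>lborel)
     = (\<integral>\<^sup>+t. (\<integral>\<^sup>+a. G (a + e t) * indicator {0..1::real} t \<partial>lborel) \<partial>lborel)"
    by (rule lborel_pair.Fubini') measurable
  also have "\<dots> = (\<integral>\<^sup>+t. (\<integral>\<^sup>+w. G w \<partial>lborel) * indicator {0..1::real} t \<partial>lborel)"
    by (intro nn_integral_cong) (simp add: nn_integral_multc nn_integral_lborel_shift)
  also have "\<dots> = (\<integral>\<^sup>+w. G w \<partial>lborel)"
    by (subst nn_integral_cmult_indicator) auto
  finally show ?thesis by (simp add: G_def)
qed

text \<open>The point is uniformity: \<open>\<delta>\<close> depends on \<open>p\<close>,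
  \<open>r\<close> and \<open>\<eta>\<close> alone and serves all functions, points and domains.
  This is what turns convergence in the metric into locally uniform convergence.\<close>

lemma holomorphic_small_if_lp_integral_small:
  assumes p: "1 \<le> p" and r: "0 < r" and \<eta>: "0 < \<eta>"
  obtains \<delta> where "0 < \<delta>"
    "\<And>f z D. f holomorphic_on D \<Longrightarrow> ball z (2 * r) \<subseteq> D \<Longrightarrow> lp_integral p D f < ennreal \<delta> \<Longrightarrow> cmod (f z) < \<eta>"
proof -
  \<comment> \<open>In the final estimate the term with \<open>s\<close> amounts to a quarter, and
    the term with \<open>\<delta>\<close> to a half, of
    \<open>\<eta> * (pi * (r / 2)\<^sup>2)\<close>; together they give the
    \<open>3/4\<close>.\<close>
  define s where "s = \<eta> / 128"
  define K where "K = s powr (1 - p)"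
  have s: "0 < s" and K: "0 < K"
    using \<eta> by (auto simp: s_def K_def)
  define \<delta> where "\<delta> = \<eta> * pi * r\<^sup>2 / 16 / K"
  have \<delta>: "0 < \<delta>"
    using \<eta> r K by (simp add: \<delta>_def)
  have "cmod (f z) < \<eta>"
    if hol: "f holomorphic_on D" and sub: "ball z (2 * r) \<subseteq> D" and small: "lp_integral p D f < ennreal \<delta>" for f z D
  proof -
    \<comment> \<open>This replaces Hoelder's inequality when passing from the p-th power to the
      first: above \<open>s\<close> the factor \<open>x powr (1 - p)\<close> is at most
      \<open>K\<close>, as \<open>1 - p\<close> is not positive.\<close>
    have split: "x \<le> s + K * x powr p" if "0 \<le> x" for x
    proof (cases "x \<le> s")
      case True
      then show ?thesis using K by (simp add: add_increasing2)
    next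
      case False
      have "x = x powr (1 - p) * x powr p"
        using False s by (simp flip: powr_add)
      also have "\<dots> \<le> K * x powr p"
        unfolding K_def using False s p by (intro mult_right_mono powr_mono2') auto
      finally show ?thesis using s by simp
    qed
    define h where "h w = ennreal (cmod (f w) powr p) * indicator (ball z (2 * r)) w" for w
    define F where "F = (\<lambda>w. if w \<in> ball z (2 * r) then f w else 0)"
    have "F holomorphic_on ball z (2 * r)"
      by (rule holomorphic_transform[OF holomorphic_on_subset[OF hol sub]]) (simp add: F_def)
    then have "F \<in> borel_measurable borel"
      by (intro borel_measurable_holomorphic_extension[of "ball z (2 * r)"]) (auto simp: F_def)
    moreover have "h = (\<lambda>w. ennreal (cmod (F w) powr p))"
      using p by (auto simp: h_def F_def fun_eq_iff)
    ultimately have h[measurable]: "h \<in> borel_measurable borel"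
      by simp
    have "(\<integral>\<^sup>+w. h w \<partial>lborel) \<le> lp_integral p D f"
      unfolding lp_integral_def h_def using sub by (intro nn_integral_mono) (auto simp: indicator_def)
    with small have "(\<integral>\<^sup>+w. h w \<partial>lborel) < ennreal \<delta>" by simp
    then obtain i where i: "(\<integral>\<^sup>+w. h w \<partial>lborel) = ennreal i" "0 \<le> i" "i < \<delta>"
      by (cases "\<integral>\<^sup>+w. h w \<partial>lborel") (auto simp: ennreal_less_iff)
    have "(\<integral>\<^sup>+w. ennreal (cmod (f w)) * indicator (ball z (2 * r)) w \<partial>lborel)
        \<le> (\<integral>\<^sup>+w. ennreal s * indicator (ball z (2 * r)) w + ennreal K * h w \<partial>lborel)"
    proof (intro nn_integral_mono)
      fix w
      have "ennreal (cmod (f w)) \<le> ennreal s + ennreal K * ennreal (cmod (f w) powr p)"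
        using split[of "cmod (f w)"] s K by (simp add: ennreal_leI flip: ennreal_mult ennreal_plus)
      then show "ennreal (cmod (f w)) * indicator (ball z (2 * r)) w
          \<le> ennreal s * indicator (ball z (2 * r)) w + ennreal K * h w"
        by (auto simp: h_def indicator_def)
    qed
    also have "\<dots> = ennreal s * ennreal (pi * (2 * r)\<^sup>2) + ennreal K * ennreal i"
    proof -
      have "(\<lambda>w. ennreal s * indicator (ball z (2 * r)) w) \<in> borel_measurable lborel"
        by (intro borel_measurable_times_ennreal borel_measurable_const borel_measurable_indicator) simp
      then show ?thesis
        using r i by (subst nn_integral_add)
          (auto simp: nn_integral_cmult nn_integral_cmult_indicator emeasure_ball_complex)
    qed
    also have "\<dots> = ennreal (s * (pi * (2 * r)\<^sup>2) + K * i)"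
      using s r K i by (simp flip: ennreal_mult ennreal_plus)
    finally have "(\<integral>\<^sup>+w. ennreal (cmod (f w)) * indicator (ball z (2 * r)) w \<partial>lborel)
        \<le> ennreal (s * (pi * (2 * r)\<^sup>2) + K * i)" .
    from order_trans[OF norm_le_area_mean[OF holomorphic_on_subset[OF hol sub] r] mult_left_mono[OF this]]
    have "ennreal (cmod (f z)) * ennreal (pi * (r / 2)\<^sup>2) \<le> 2 * ennreal (s * (pi * (2 * r)\<^sup>2) + K * i)"
      by simp
    then have "cmod (f z) * (pi * (r / 2)\<^sup>2) \<le> 2 * (s * (pi * (2 * r)\<^sup>2) + K * i)"
    proof -
      have *: "x * y \<le> 2 * Q" if "ennreal x * ennreal y \<le> 2 * ennreal Q" "0 \<le> Q" "0 \<le> x" "0 \<le> y" for x y Q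
        using that by (simp add: ennreal_mult[symmetric] flip: ennreal_numeral)
      assume "ennreal (cmod (f z)) * ennreal (pi * (r / 2)\<^sup>2) \<le> 2 * ennreal (s * (pi * (2 * r)\<^sup>2) + K * i)"
      from *[OF this] show ?thesis using s K i by simp
    qed
    also have "\<dots> < 2 * (s * (pi * (2 * r)\<^sup>2) + K * \<delta>)"
      using K i by simp
    also have "\<dots> = 3/4 * \<eta> * (pi * (r / 2)\<^sup>2)"
      using K by (simp add: s_def \<delta>_def power2_eq_square field_simps)
    finally have "cmod (f z) < 3/4 * \<eta>"
      using r by (simp add: mult_less_cancel_right)
    then show ?thesis using \<eta> by simp
  qed
  then show ?thesis using that \<delta> by blast
qed

section \<open>Integral means\<close>

text \<open>When one argument is 0, the claim comes down to \<open>t powr p \<le> t\<close> for a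
  weight \<open>t\<close> in the unit interval; otherwise it is convexity on the open
  half-line.\<close>

lemma powr_convex_nonneg:
  fixes x y s p :: real
  assumes p: "1 \<le> p" and xy: "0 \<le> x" "0 \<le> y" and s: "0 \<le> s" "s \<le> 1"
  shows "((1 - s) * x + s * y) powr p \<le> (1 - s) * x powr p + s * y powr p"
proof -
  have le_self: "t powr p \<le> t" if "0 \<le> t" "t \<le> 1" for t :: real
    using powr_mono'[of 1 p t] that p by auto
  consider "x = 0" | "y = 0" | "0 < x" "0 < y"
    using xy by fastforce
  then show ?thesis
  proof cases
    case 1
    then show ?thesis
      using le_self[of s] s xy p by (simp add: powr_mult mult_right_mono)
  next
    case 2
    then show ?thesis
      using le_self[of "1 - s"] s xy p by (simp add: powr_mult mult_right_mono)
  next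
    case 3
    then show ?thesis
      using convex_onD[OF powr_convex[OF p], of s x y] s by simp
  qed
qed

text \<open>Convexity applied to \<open>x / A\<close> and \<open>y / B\<close> with weights
  \<open>A / (A + B)\<close> and \<open>B / (A + B)\<close>. If \<open>A\<close> and
  \<open>B\<close> bound the norms of two functions, integrating this inequality yields Minkowski's
  inequality, because the weights add up to 1.\<close>

lemma add_powr_le_weighted:
  fixes x y A B p :: real
  assumes p: "1 \<le> p" and xy: "0 \<le> x" "0 \<le> y" and AB: "0 < A" "0 < B"
  shows "(x + y) powr p \<le>
    (A + B) powr p * (A / (A + B)) / A powr p * x powr p + (A + B) powr p * (B / (A + B)) / B powr p * y powr p"
proof -
  define s where "s = B / (A + B)"
  have s: "0 \<le> s" "s \<le> 1" "1 - s = A / (A + B)"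
    using AB by (auto simp: s_def field_simps)
  have "(A + B) * ((1 - s) * (x / A)) = x" "(A + B) * (s * (y / B)) = y"
    using AB unfolding s(3) unfolding s_def by simp_all
  then have "x + y = (A + B) * ((1 - s) * (x / A) + s * (y / B))"
    by (simp only: distrib_left)
  then have "(x + y) powr p = (A + B) powr p * ((1 - s) * (x / A) + s * (y / B)) powr p"
    using AB xy s by (simp add: powr_mult)
  also have "\<dots> \<le> (A + B) powr p * ((1 - s) * (x / A) powr p + s * (y / B) powr p)"
    using xy AB s p by (intro mult_left_mono powr_convex_nonneg) auto
  also have "\<dots> = (A + B) powr p * (A / (A + B)) / A powr p * x powr p
      + (A + B) powr p * (B / (A + B)) / B powr p * y powr p"
    unfolding s(3) using AB xy by (simp add: s_def powr_divide algebra_simps)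
  finally show ?thesis .
qed

lemma borel_measurable_lp_integrand [measurable]:
  assumes [measurable]: "f \<in> borel_measurable borel" "D \<in> sets borel"
  shows "(\<lambda>z. ennreal (cmod (f z) powr p) * indicator D z) \<in> borel_measurable borel"
  by measurable

lemma lp_integral_add_le:
  assumes p: "1 \<le> p" and AB: "0 < A" "0 < B"
    and meas: "f \<in> borel_measurable borel" "g \<in> borel_measurable borel" "D \<in> sets borel"
    and f: "lp_integral p D f \<le> ennreal (A powr p)" and g: "lp_integral p D g \<le> ennreal (B powr p)"
  shows "lp_integral p D (\<lambda>z. f z + g z) \<le> ennreal ((A + B) powr p)"
proof -
  note [measurable] = meas
  define a where "a = (A + B) powr p * (A / (A + B)) / A powr p"
  define b where "b = (A + B) powr p * (B / (A + B)) / B powr p"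
  have ab: "0 \<le> a" "0 \<le> b"
    using AB by (auto simp: a_def b_def)
  have "lp_integral p D (\<lambda>z. f z + g z) \<le>
      (\<integral>\<^sup>+z. ennreal a * (ennreal (cmod (f z) powr p) * indicator D z)
        + ennreal b * (ennreal (cmod (g z) powr p) * indicator D z) \<partial>lborel)"
    unfolding lp_integral_def
  proof (intro nn_integral_mono)
    fix z
    have "cmod (f z + g z) powr p \<le> (cmod (f z) + cmod (g z)) powr p"
      using p by (intro powr_mono2 norm_triangle_ineq) auto
    also have "\<dots> \<le> a * cmod (f z) powr p + b * cmod (g z) powr p"
      unfolding a_def b_def using p AB by (intro add_powr_le_weighted) auto
    finally have "ennreal (cmod (f z + g z) powr p)
        \<le> ennreal a * ennreal (cmod (f z) powr p) + ennreal b * ennreal (cmod (g z) powr p)"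
      using ab by (simp add: ennreal_leI flip: ennreal_mult ennreal_plus)
    then show "ennreal (cmod (f z + g z) powr p) * indicator D z
        \<le> ennreal a * (ennreal (cmod (f z) powr p) * indicator D z)
          + ennreal b * (ennreal (cmod (g z) powr p) * indicator D z)"
      by (auto split: split_indicator)
  qed
  also have "\<dots> = ennreal a * lp_integral p D f + ennreal b * lp_integral p D g"
    unfolding lp_integral_def by (simp add: nn_integral_add nn_integral_cmult)
  also have "\<dots> \<le> ennreal a * ennreal (A powr p) + ennreal b * ennreal (B powr p)"
    using f g by (intro add_mono mult_left_mono) auto
  also have "\<dots> = ennreal (a * A powr p + b * B powr p)"
    using ab by (simp flip: ennreal_mult ennreal_plus)
  also have "a * A powr p + b * B powr p = (A + B) powr p * (A / (A + B) + B / (A + B))"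
    unfolding a_def b_def using AB by (simp add: distrib_left)
  also have "A / (A + B) + B / (A + B) = 1"
    using AB by (simp flip: add_divide_distrib)
  finally show ?thesis by simp
qed

lemma lp_norm_nonneg [simp]: "0 \<le> lp_norm p D f"
  by (simp add: lp_norm_def)

text \<open>Finiteness matters: \<open>enn2real\<close> sends \<open>top\<close> to 0, so a function
  with infinite integral would have norm 0.\<close>

lemma lp_integral_eq_lp_norm_powr:
  assumes "0 < p" "lp_integral p D f < top"
  shows "lp_integral p D f = ennreal (lp_norm p D f powr p)"
  using assms by (simp add: lp_norm_def powr_powr)

lemma lp_integral_le_iff_lp_norm_le:
  assumes "0 < p" "lp_integral p D f < top" "0 \<le> A"
  shows "lp_integral p D f \<le> ennreal (A powr p) \<longleftrightarrow> lp_norm p D f \<le> A"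
proof -
  have "lp_norm p D f powr p \<le> A powr p \<longleftrightarrow> lp_norm p D f \<le> A"
    using assms(1,3) powr_mono2[of p "lp_norm p D f" A] powr_less_mono2[of p A "lp_norm p D f"]
    by fastforce
  then show ?thesis
    using lp_integral_eq_lp_norm_powr[OF assms(1,2)] by simp
qed

lemma lp_integral_add_finite:
  assumes p: "1 \<le> p"
    and meas: "f \<in> borel_measurable borel" "g \<in> borel_measurable borel" "D \<in> sets borel"
    and fin: "lp_integral p D f < top" "lp_integral p D g < top"
  shows "lp_integral p D (\<lambda>z. f z + g z) < top"
proof -
  have "lp_integral p D (\<lambda>z. f z + g z)
      \<le> ennreal ((lp_norm p D f + 1 + (lp_norm p D g + 1)) powr p)"
    using p fin meas
    by (intro lp_integral_add_le) (auto simp: lp_integral_le_iff_lp_norm_le add_nonneg_pos)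
  then show ?thesis
    using le_less_trans ennreal_less_top by fastforce
qed

lemma lp_norm_triangle:
  assumes p: "1 \<le> p"
    and meas: "f \<in> borel_measurable borel" "g \<in> borel_measurable borel" "D \<in> sets borel"
    and fin: "lp_integral p D f < top" "lp_integral p D g < top"
  shows "lp_norm p D (\<lambda>z. f z + g z) \<le> lp_norm p D f + lp_norm p D g"
proof (rule field_le_epsilon)
  \<comment> \<open>The slack \<open>e / 2\<close> keeps both bounds positive when a norm vanishes,
    since \<open>lp_integral_add_le\<close> divides by them.\<close>
  fix e :: real assume e: "0 < e"
  have "lp_integral p D (\<lambda>z. f z + g z)
      \<le> ennreal ((lp_norm p D f + e / 2 + (lp_norm p D g + e / 2)) powr p)"
    using p fin meas e
    by (intro lp_integral_add_le) (auto simp: lp_integral_le_iff_lp_norm_le add_nonneg_pos)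
  then have "lp_norm p D (\<lambda>z. f z + g z) \<le> lp_norm p D f + e / 2 + (lp_norm p D g + e / 2)"
    using p e lp_integral_add_finite[OF assms] by (subst (asm) lp_integral_le_iff_lp_norm_le) auto
  then show "lp_norm p D (\<lambda>z. f z + g z) \<le> lp_norm p D f + lp_norm p D g + e"
    by simp
qed

lemma lp_integral_scale:
  assumes "f \<in> borel_measurable borel" "D \<in> sets borel"
  shows "lp_integral p D (\<lambda>z. c * f z) = ennreal (cmod c powr p) * lp_integral p D f"
  unfolding lp_integral_def using assms
  by (subst nn_integral_cmult[symmetric]) (auto simp: norm_mult powr_mult ennreal_mult mult.assoc)

lemma lp_norm_scale:
  assumes "f \<in> borel_measurable borel" "D \<in> sets borel" "0 < p"
  shows "lp_norm p D (\<lambda>z. c * f z) = cmod c * lp_norm p D f"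
  unfolding lp_norm_def lp_integral_scale[OF assms(1,2)]
  using assms(3) by (simp add: enn2real_mult powr_mult powr_powr)

lemma lp_integral_mono:
  assumes "D \<subseteq> E" shows "lp_integral p D f \<le> lp_integral p E f"
  unfolding lp_integral_def using assms by (intro nn_integral_mono) (auto split: split_indicator)

text \<open>Fatou's lemma. No measurability of \<open>f\<close> has to be assumed, since its
  integrand is the pointwise \<open>liminf\<close> of measurable ones.\<close>

lemma lp_integral_lower_semicontinuous:
  assumes meas: "\<And>k::nat. g k \<in> borel_measurable borel" "D \<in> sets borel" and p: "0 < p"
    and lim: "\<And>z. z \<in> D \<Longrightarrow> (\<lambda>k. g k z) \<longlonglongrightarrow> f z"
    and bound: "\<forall>\<^sub>F k in sequentially. lp_integral p D (g k) \<le> C"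
  shows "lp_integral p D f \<le> C"
proof -
  have "lp_integral p D f = (\<integral>\<^sup>+z. liminf (\<lambda>k. ennreal (cmod (g k z) powr p) * indicator D z) \<partial>lborel)"
    unfolding lp_integral_def
  proof (intro nn_integral_cong)
    fix z
    show "ennreal (cmod (f z) powr p) * indicator D z
        = liminf (\<lambda>k. ennreal (cmod (g k z) powr p) * indicator D z)"
    proof (cases "z \<in> D")
      case True
      have "(\<lambda>k. ennreal (cmod (g k z) powr p)) \<longlonglongrightarrow> ennreal (cmod (f z) powr p)"
        using p lim[OF True] by (intro tendsto_ennrealI tendsto_powr2 tendsto_norm tendsto_const) auto
      from lim_imp_Liminf[OF sequentially_bot this] show ?thesis
        using True by simp
    qed (simp add: Liminf_const)
  qed
  also have "\<dots> \<le> liminf (\<lambda>k. lp_integral p D (g k))"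
    unfolding lp_integral_def using meas by (intro nn_integral_liminf) auto
  also have "\<dots> \<le> C"
    using bound by (metis (mono_tags, lifting) Liminf_le eventually_mono trivial_limit_sequentially)
  finally show ?thesis .
qed

section \<open>The metric space and its residual sets\<close>

definition ratio :: "real \<Rightarrow> real" where
  "ratio x = x / (1 + x)"

lemma ratio_mono: "0 \<le> x \<Longrightarrow> x \<le> y \<Longrightarrow> ratio x \<le> ratio y"
  by (simp add: ratio_def field_simps)

lemma ratio_bounds: "0 \<le> x \<Longrightarrow> 0 \<le> ratio x \<and> ratio x \<le> 1"
  by (simp add: ratio_def)

lemma ratio_add: "0 \<le> x \<Longrightarrow> 0 \<le> y \<Longrightarrow> ratio (x + y) \<le> ratio x + ratio y"
proof -
  assume *: "0 \<le> x" "0 \<le> y"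
  have "ratio (x + y) = x / (1 + (x + y)) + y / (1 + (x + y))"
    by (simp add: ratio_def add_divide_distrib)
  also have "\<dots> \<le> ratio x + ratio y"
    unfolding ratio_def using * by (intro add_mono divide_left_mono) (auto intro!: mult_pos_pos)
  finally show ?thesis .
qed

text \<open>The setting shared by all three parts of the theorem; they differ only in the functions
  that blow up at the boundary points.\<close>

locale below_space =
  fixes \<Omega> :: "complex set" and q :: ereal and p :: "nat \<Rightarrow> real"
  assumes open_\<Omega>: "open \<Omega>" and bounded_\<Omega>: "bounded \<Omega>" and adm: "admissible_seq q p"
begin

abbreviation "X \<equiv> OLbelow q \<Omega>"
abbreviation "d \<equiv> OLdist \<Omega> p"
abbreviation "N \<equiv> \<lambda>j. lp_norm (p j) \<Omega>"

lemma p_strict_mono: "strict_mono p"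
  using adm by (simp add: admissible_seq_def strict_mono_Suc_iff)

lemma p_gt_1: "1 < p j"
proof -
  have "p 0 \<le> p j"
    using p_strict_mono by (simp add: strict_mono_less_eq)
  then show ?thesis
    using adm by (simp add: admissible_seq_def)
qed

lemma p_less_q: "ereal (p j) < q"
proof -
  have "ereal (p (Suc j)) \<le> q"
  proof (rule LIMSEQ_le_const[of "\<lambda>j. ereal (p j)"])
    show "(\<lambda>j. ereal (p j)) \<longlonglongrightarrow> q"
      using adm by (simp add: admissible_seq_def)
    show "\<exists>M. \<forall>n\<ge>M. ereal (p (Suc j)) \<le> ereal (p n)"
      using p_strict_mono by (intro exI[of _ "Suc j"]) (simp add: strict_mono_less_eq)
  qed
  moreover have "ereal (p j) < ereal (p (Suc j))"
    using p_strict_mono by (simp add: strict_mono_Suc_iff)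
  ultimately show ?thesis by (rule less_le_trans[rotated])
qed

lemma p_cofinal:
  assumes "ereal r < q"
  obtains j where "r \<le> p j"
proof -
  have "\<forall>\<^sub>F j in sequentially. ereal r < ereal (p j)"
    using adm assms by (intro order_tendstoD) (auto simp: admissible_seq_def)
  then obtain j where "r < p j"
    by (auto simp: eventually_sequentially)
  then show ?thesis by (intro that[of j]) simp
qed

lemma sets_\<Omega> [simp]: "\<Omega> \<in> sets borel"
  using open_\<Omega> by simp

lemma X_holomorphic: "f \<in> X \<Longrightarrow> f holomorphic_on \<Omega>"
  by (simp add: OLbelow_def)

lemma X_zero_outside: "f \<in> X \<Longrightarrow> z \<notin> \<Omega> \<Longrightarrow> f z = 0"
  by (simp add: OLbelow_def)

lemma X_measurable: "f \<in> X \<Longrightarrow> f \<in> borel_measurable borel"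
  by (rule borel_measurable_holomorphic_extension[OF open_\<Omega>]) (auto simp: OLbelow_def)

lemma X_finite: "f \<in> X \<Longrightarrow> 1 \<le> r \<Longrightarrow> ereal r < q \<Longrightarrow> lp_integral r \<Omega> f < top"
  by (simp add: OLbelow_def OLp_def)

lemma X_finite_p: "f \<in> X \<Longrightarrow> lp_integral (p j) \<Omega> f < top"
  using X_finite p_gt_1 p_less_q by (simp add: less_imp_le)

lemma X_I:
  assumes "f holomorphic_on \<Omega>" "\<And>z. z \<notin> \<Omega> \<Longrightarrow> f z = 0"
    "\<And>r. 1 \<le> r \<Longrightarrow> ereal r < q \<Longrightarrow> lp_integral r \<Omega> f < top"
  shows "f \<in> X"
  using assms by (simp add: OLbelow_def OLp_def)

lemma X_add_scale:
  assumes f: "f \<in> X" and g: "g \<in> X"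
  shows "(\<lambda>z. f z + t * g z) \<in> X"
proof (rule X_I)
  show "(\<lambda>z. f z + t * g z) holomorphic_on \<Omega>"
    using f g by (intro holomorphic_intros X_holomorphic)
  fix r :: real assume r: "1 \<le> r" "ereal r < q"
  have "lp_integral r \<Omega> (\<lambda>z. t * g z) < top"
    using g r X_finite[OF g r] by (simp add: lp_integral_scale X_measurable ennreal_mult_less_top)
  then show "lp_integral r \<Omega> (\<lambda>z. f z + t * g z) < top"
    using f g r X_finite[OF f r] X_measurable[OF f] X_measurable[OF g]
    by (intro lp_integral_add_finite) auto
qed (use f g in \<open>auto simp: X_zero_outside\<close>)

lemma X_diff:
  assumes "f \<in> X" "g \<in> X"
  shows "(\<lambda>z. f z - g z) \<in> X"
  using X_add_scale[OF assms, of "-1"] by simp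

lemma N_triangle:
  assumes "f \<in> X" "g \<in> X"
  shows "N j (\<lambda>z. f z + g z) \<le> N j f + N j g"
  using assms p_gt_1[of j] by (intro lp_norm_triangle) (auto simp: X_measurable X_finite_p less_imp_le)

lemma N_scale:
  assumes "f \<in> X"
  shows "N j (\<lambda>z. t * f z) = cmod t * N j f"
  using assms p_gt_1[of j] by (intro lp_norm_scale) (auto simp: X_measurable)

text \<open>A single norm of the sequence, whichever \<open>j\<close>, controls all values at points
  whose \<open>2 * r\<close>-ball lies in \<open>\<Omega>\<close>.\<close>

lemma X_small_if_N_small:
  assumes r: "0 < r" and \<eta>: "0 < \<eta>"
  obtains \<delta> where "0 < \<delta>" "\<And>f z. f \<in> X \<Longrightarrow> ball z (2 * r) \<subseteq> \<Omega> \<Longrightarrow> N j f < \<delta> \<Longrightarrow> cmod (f z) < \<eta>"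
proof -
  have pj: "0 < p j" "1 \<le> p j" using p_gt_1[of j] by auto
  obtain \<delta> where \<delta>: "0 < \<delta>" "\<And>f z D. f holomorphic_on D \<Longrightarrow> ball z (2 * r) \<subseteq> D \<Longrightarrow>
      lp_integral (p j) D f < ennreal \<delta> \<Longrightarrow> cmod (f z) < \<eta>"
    using holomorphic_small_if_lp_integral_small[OF pj(2) r \<eta>] by metis
  show ?thesis
  proof
    show "0 < \<delta> powr (1 / p j)" using \<delta> by simp
    fix f z assume f: "f \<in> X" "ball z (2 * r) \<subseteq> \<Omega>" and N: "N j f < \<delta> powr (1 / p j)"
    have "N j f powr p j < (\<delta> powr (1 / p j)) powr p j"
      using N pj by (intro powr_less_mono2) auto
    then have "lp_integral (p j) \<Omega> f < ennreal \<delta>"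
      using lp_integral_eq_lp_norm_powr[OF pj(1) X_finite_p[OF f(1)]] \<delta>(1) pj
      by (simp add: powr_powr ennreal_less_iff)
    then show "cmod (f z) < \<eta>"
      using \<delta>(2) f X_holomorphic by blast
  qed
qed

text \<open>Vanishing of a norm gives equality at every point, not just almost everywhere: each
  value is smaller than any \<open>\<eta>\<close> by the pointwise bound, and off
  \<open>\<Omega>\<close> both functions are 0.\<close>

lemma X_eq_if_N_zero:
  assumes "f \<in> X" "g \<in> X" "N j (\<lambda>z. f z - g z) = 0"
  shows "f = g"
proof
  fix z
  show "f z = g z"
  proof (cases "z \<in> \<Omega>")
    case True
    then obtain e where e: "0 < e" "ball z e \<subseteq> \<Omega>"
      using open_\<Omega> open_contains_ball by blast
    have "cmod (f z - g z) < \<eta>" if \<eta>: "0 < \<eta>" for \<eta>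
    proof -
      obtain \<delta> where "0 < \<delta>"
        "\<And>f z. f \<in> X \<Longrightarrow> ball z (2 * (e / 2)) \<subseteq> \<Omega> \<Longrightarrow> N j f < \<delta> \<Longrightarrow> cmod (f z) < \<eta>"
        using X_small_if_N_small[of "e / 2" \<eta> j] e \<eta> by auto
      from this(2)[OF X_diff[OF assms(1,2)], of z] this(1) show ?thesis
        using assms(3) e by simp
    qed
    from this[of "cmod (f z - g z)"] show ?thesis by auto
  qed (use assms in \<open>simp add: X_zero_outside\<close>)
qed

lemma d_ratio: "d f g = (\<Sum>j. (1/2) ^ Suc j * ratio (N j (\<lambda>z. f z - g z)))"
  by (simp add: OLdist_def ratio_def)

lemma summable_ratio: "summable (\<lambda>j. (1/2) ^ Suc j * ratio (N j (h j)))"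
proof (rule summable_comparison_test')
  show "summable (\<lambda>j. (1/2::real) ^ Suc j)"
    by (simp add: summable_geometric)
  show "norm ((1/2) ^ Suc j * ratio (N j (h j))) \<le> (1/2) ^ Suc j" for j
    using ratio_bounds[of "N j (h j)"] by (simp add: abs_mult)
qed

lemma d_ge_term: "(1/2) ^ Suc j * ratio (N j (\<lambda>z. f z - g z)) \<le> d f g"
proof -
  have "sum (\<lambda>j. (1/2) ^ Suc j * ratio (N j (\<lambda>z. f z - g z))) {j}
      \<le> (\<Sum>j. (1/2) ^ Suc j * ratio (N j (\<lambda>z. f z - g z)))"
    using ratio_bounds by (intro sum_le_suminf summable_ratio) auto
  then show ?thesis by (simp add: d_ratio)
qed

lemma N_small_if_d_small:
  assumes "0 < \<eta>"
  obtains e where "0 < e" "\<And>f g. d f g < e \<Longrightarrow> N j (\<lambda>z. f z - g z) < \<eta>"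
proof
  show "0 < (1/2) ^ Suc j * ratio \<eta>"
    using assms by (simp add: ratio_def)
  fix f g assume less: "d f g < (1/2) ^ Suc j * ratio \<eta>"
  show "N j (\<lambda>z. f z - g z) < \<eta>"
  proof (rule ccontr)
    assume "\<not> ?thesis"
    then have "(1/2) ^ Suc j * ratio \<eta> \<le> (1/2) ^ Suc j * ratio (N j (\<lambda>z. f z - g z))"
      using assms by (intro mult_left_mono ratio_mono) auto
    then show False
      using less d_ge_term[of j f g] by linarith
  qed
qed

text \<open>Tannery's theorem: the series is dominated by \<open>(1/2) ^ Suc j\<close>, so the limit
  may be taken term by term.\<close>

lemma d_tendsto_0:
  assumes "\<And>j. (\<lambda>k. N j (\<lambda>z. f z - g k z)) \<longlonglongrightarrow> 0"
  shows "(\<lambda>k::nat. d f (g k)) \<longlonglongrightarrow> 0"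
proof -
  have "(\<lambda>k. \<Sum>j. (1/2) ^ Suc j * ratio (N j (\<lambda>z. f z - g k z))) \<longlonglongrightarrow> (\<Sum>j. (1/2) ^ Suc j * 0)"
  proof (rule tannerys_theorem[THEN conjunct2, THEN conjunct2])
    fix j
    have "(\<lambda>k. ratio (N j (\<lambda>z. f z - g k z))) \<longlonglongrightarrow> 0 / (1 + 0)"
      unfolding ratio_def by (intro tendsto_intros assms) simp
    then show "(\<lambda>k. (1/2) ^ Suc j * ratio (N j (\<lambda>z. f z - g k z))) \<longlonglongrightarrow> (1/2) ^ Suc j * 0"
      by (intro tendsto_mult tendsto_const) simp
  next
    have "norm ((1/2) ^ Suc j * ratio (N j (\<lambda>z. f z - g k z))) \<le> (1/2) ^ Suc j" for j k
      using ratio_bounds[of "N j (\<lambda>z. f z - g k z)"] by (simp add: abs_mult)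
    then show "\<forall>\<^sub>F (j, k) in sequentially \<times>\<^sub>F sequentially.
        norm ((1/2) ^ Suc j * ratio (N j (\<lambda>z. f z - g k z))) \<le> (1/2) ^ Suc j"
      by (intro always_eventually) auto
    show "summable (\<lambda>j. (1/2::real) ^ Suc j)"
      by (simp add: summable_geometric)
  qed simp
  then show ?thesis by (simp add: d_ratio)
qed

text \<open>Nonnegativity and symmetry hold for arbitrary functions. Membership in \<open>X\<close>
  enters through the triangle inequality, where the integrals must be finite, and through separation
  of points, for which the first norm is enough.\<close>

sublocale Metric_space X d
proof
  fix f g h
  show "0 \<le> d f g"
    unfolding d_ratio using ratio_bounds by (intro suminf_nonneg summable_ratio) auto
  have "N j (\<lambda>z. f z - g z) = N j (\<lambda>z. g z - f z)" for j
    by (simp add: lp_norm_def lp_integral_def norm_minus_commute)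
  then show "d f g = d g f"
    by (simp add: d_ratio)
  show "d f g = 0 \<longleftrightarrow> f = g" if "f \<in> X" "g \<in> X"
  proof
    assume "d f g = 0"
    then have "ratio (N 0 (\<lambda>z. f z - g z)) \<le> 0"
      using d_ge_term[of 0 f g] by simp
    moreover have "0 \<le> N 0 (\<lambda>z. f z - g z)"
      by simp
    ultimately have "N 0 (\<lambda>z. f z - g z) = 0"
      unfolding ratio_def by (smt (verit) divide_pos_pos)
    then show "f = g"
      using X_eq_if_N_zero that by blast
  next
    assume "f = g"
    then show "d f g = 0"
      by (simp add: d_ratio lp_norm_def lp_integral_def ratio_def)
  qed
  show "d f h \<le> d f g + d g h" if "f \<in> X" "g \<in> X" "h \<in> X"
  proof -
    have "d f h \<le> (\<Sum>j. (1/2) ^ Suc j * ratio (N j (\<lambda>z. f z - g z)) + (1/2) ^ Suc j * ratio (N j (\<lambda>z. g z - h z)))"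
      unfolding d_ratio
    proof (intro suminf_le summable_add summable_ratio)
      fix j
      have "N j (\<lambda>z. f z - h z) \<le> N j (\<lambda>z. f z - g z) + N j (\<lambda>z. g z - h z)"
        using N_triangle[of "\<lambda>z. f z - g z" "\<lambda>z. g z - h z" j] that by (simp add: X_diff)
      then have "ratio (N j (\<lambda>z. f z - h z)) \<le> ratio (N j (\<lambda>z. f z - g z) + N j (\<lambda>z. g z - h z))"
        by (intro ratio_mono) auto
      also have "\<dots> \<le> ratio (N j (\<lambda>z. f z - g z)) + ratio (N j (\<lambda>z. g z - h z))"
        by (intro ratio_add) auto
      finally show "(1/2) ^ Suc j * ratio (N j (\<lambda>z. f z - h z))
          \<le> (1/2) ^ Suc j * ratio (N j (\<lambda>z. f z - g z)) + (1/2) ^ Suc j * ratio (N j (\<lambda>z. g z - h z))"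
        by (simp add: distrib_left[symmetric] mult_left_mono)
    qed
    also have "\<dots> = d f g + d g h"
      unfolding d_ratio by (intro suminf_add[symmetric] summable_ratio)
    finally show ?thesis .
  qed
qed

lemma uniformly_close_if_d_small:
  assumes r: "0 < r" and \<eta>: "0 < \<eta>"
  obtains e where "0 < e"
    "\<And>f g z. f \<in> X \<Longrightarrow> g \<in> X \<Longrightarrow> d f g < e \<Longrightarrow> ball z (2 * r) \<subseteq> \<Omega> \<Longrightarrow> cmod (f z - g z) < \<eta>"
proof -
  obtain \<delta> where \<delta>: "0 < \<delta>"
    "\<And>f z. f \<in> X \<Longrightarrow> ball z (2 * r) \<subseteq> \<Omega> \<Longrightarrow> N 0 f < \<delta> \<Longrightarrow> cmod (f z) < \<eta>"
    using X_small_if_N_small[OF r \<eta>, of 0] by metis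
  obtain e where e: "0 < e" "\<And>f g. d f g < e \<Longrightarrow> N 0 (\<lambda>z. f z - g z) < \<delta>"
    using N_small_if_d_small[OF \<delta>(1), of 0] by metis
  show ?thesis
    using \<delta>(2)[OF X_diff] e by (intro that[of e]) auto
qed

lemma pointwise_convergence:
  assumes g: "\<And>k::nat. g k \<in> X" "f \<in> X" and lim: "(\<lambda>k. d f (g k)) \<longlonglongrightarrow> 0" and z: "z \<in> \<Omega>"
  shows "(\<lambda>k. g k z) \<longlonglongrightarrow> f z"
proof (rule tendstoI)
  fix \<eta> :: real assume \<eta>: "0 < \<eta>"
  obtain e where e: "0 < e" "ball z e \<subseteq> \<Omega>"
    using open_\<Omega> open_contains_ball z by blast
  obtain e' where e': "0 < e'" "\<And>f g z. f \<in> X \<Longrightarrow> g \<in> X \<Longrightarrow> d f g < e' \<Longrightarrow>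
      ball z (2 * (e / 2)) \<subseteq> \<Omega> \<Longrightarrow> cmod (f z - g z) < \<eta>"
    using uniformly_close_if_d_small[of "e / 2" \<eta>] e \<eta> by auto
  have "\<forall>\<^sub>F k in sequentially. d f (g k) < e'"
    using lim e'(1) by (rule order_tendstoD)
  then show "\<forall>\<^sub>F k in sequentially. dist (g k z) (f z) < \<eta>"
    by eventually_elim (use e'(2)[OF g(2) g(1)] e in \<open>simp add: dist_norm norm_minus_commute\<close>)
qed

text \<open>Locally uniform limits give a holomorphic candidate \<open>f\<close>. Fatou's lemma then
  returns to the norms: letting \<open>m\<close> tend to infinity in the bound on the norm of
  \<open>\<sigma> m - \<sigma> k\<close> bounds the norm of \<open>f - \<sigma> k\<close>.\<close>

lemma complete: mcomplete
  unfolding mcomplete_def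
proof (intro allI impI)
  fix \<sigma> assume \<sigma>: "MCauchy \<sigma>"
  then have \<sigma>X: "\<sigma> k \<in> X" for k
    by (auto simp: MCauchy_def)
  have cauchy: "\<exists>K. \<forall>k\<ge>K. \<forall>m\<ge>K. d (\<sigma> k) (\<sigma> m) < e" if "0 < e" for e
    using \<sigma> that by (auto simp: MCauchy_def)
  have local: "\<exists>K. \<forall>k\<ge>K. \<forall>m\<ge>K. \<forall>w. ball w (2 * r) \<subseteq> \<Omega> \<longrightarrow> cmod (\<sigma> k w - \<sigma> m w) < \<eta>"
    if r: "0 < r" and \<eta>: "0 < \<eta>" for r \<eta>
    using uniformly_close_if_d_small[OF r \<eta>] cauchy \<sigma>X by metis
  \<comment> \<open>Taken at every point of the plane: off \<open>\<Omega>\<close> all terms are 0,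
    so \<open>f\<close> is automatically extended by 0.\<close>
  define f where "f z = lim (\<lambda>k. \<sigma> k z)" for z
  have unif: "\<exists>e>0. cball z e \<subseteq> \<Omega> \<and> uniform_limit (cball z e) \<sigma> f sequentially" if z: "z \<in> \<Omega>" for z
  proof -
    obtain e where e: "0 < e" "cball z e \<subseteq> \<Omega>"
      using open_\<Omega> open_contains_cball z by blast
    \<comment> \<open>The radius is chosen so that \<open>local\<close> applies simultaneously at
      all points of the smaller closed ball: half of \<open>e\<close> for the position of
      \<open>w\<close>, half for the ball around it.\<close>
    have sub: "ball w (2 * (e / 4)) \<subseteq> \<Omega>" if w: "w \<in> cball z (e / 2)" for w
    proof
      fix x assume "x \<in> ball w (2 * (e / 4))"
      then have "x \<in> cball z e"
        using w dist_triangle[of z x w] by simp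
      then show "x \<in> \<Omega>" using e by blast
    qed
    have "uniformly_Cauchy_on (cball z (e / 2)) \<sigma>"
      unfolding uniformly_Cauchy_on_def
    proof (intro allI impI)
      fix \<eta> :: real assume "0 < \<eta>"
      then show "\<exists>M. \<forall>x\<in>cball z (e / 2). \<forall>m\<ge>M. \<forall>n\<ge>M. dist (\<sigma> m x) (\<sigma> n x) < \<eta>"
        using local[of "e / 4" \<eta>] e sub unfolding dist_norm by (meson divide_pos_pos zero_less_numeral)
    qed
    then have "uniformly_convergent_on (cball z (e / 2)) \<sigma>"
      by (rule Cauchy_uniformly_convergent)
    then have "uniform_limit (cball z (e / 2)) \<sigma> f sequentially"
      unfolding f_def uniformly_convergent_uniform_limit_iff .
    moreover have "cball z (e / 2) \<subseteq> \<Omega>"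
      using e by (auto simp: subset_iff)
    ultimately show ?thesis
      using e by (intro exI[of _ "e / 2"]) auto
  qed
  have ptw: "(\<lambda>k. \<sigma> k z) \<longlonglongrightarrow> f z" if z: "z \<in> \<Omega>" for z
    using unif[OF z] tendsto_uniform_limitI by fastforce
  have f_hol: "f holomorphic_on \<Omega>"
    by (rule holomorphic_uniform_sequence[OF open_\<Omega>, of \<sigma>]) (use \<sigma>X X_holomorphic unif in auto)
  have f_out: "f z = 0" if "z \<notin> \<Omega>" for z
    using \<sigma>X that by (simp add: f_def X_zero_outside)
  have f_meas: "f \<in> borel_measurable borel"
    using open_\<Omega> f_hol f_out by (rule borel_measurable_holomorphic_extension)
  have tail: "\<exists>K. \<forall>k\<ge>K. lp_integral (p j) \<Omega> (\<lambda>z. f z - \<sigma> k z) \<le> ennreal (\<eta> powr p j)" if \<eta>: "0 < \<eta>" for j \<eta>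
  proof -
    have pj: "0 < p j" using p_gt_1[of j] by simp
    obtain e where e: "0 < e" "\<And>f g. d f g < e \<Longrightarrow> N j (\<lambda>z. f z - g z) < \<eta>"
      using N_small_if_d_small[OF \<eta>] by metis
    obtain K where K: "\<forall>k\<ge>K. \<forall>m\<ge>K. d (\<sigma> k) (\<sigma> m) < e"
      using cauchy[OF e(1)] by blast
    have "lp_integral (p j) \<Omega> (\<lambda>z. f z - \<sigma> k z) \<le> ennreal (\<eta> powr p j)" if k: "k \<ge> K" for k
    proof (rule lp_integral_lower_semicontinuous)
      show "(\<lambda>z. \<sigma> m z - \<sigma> k z) \<in> borel_measurable borel" for m
        using \<sigma>X X_diff X_measurable by blast
      show "(\<lambda>m. \<sigma> m z - \<sigma> k z) \<longlonglongrightarrow> f z - \<sigma> k z" if "z \<in> \<Omega>" for z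
        using that by (intro tendsto_intros ptw)
      have "lp_integral (p j) \<Omega> (\<lambda>z. \<sigma> m z - \<sigma> k z) \<le> ennreal (\<eta> powr p j)" if m: "m \<ge> K" for m
        using K e(2)[of "\<sigma> m" "\<sigma> k"] k m \<eta> \<sigma>X pj
        by (subst lp_integral_le_iff_lp_norm_le) (auto simp: X_diff X_finite_p less_imp_le)
      then show "\<forall>\<^sub>F m in sequentially. lp_integral (p j) \<Omega> (\<lambda>z. \<sigma> m z - \<sigma> k z) \<le> ennreal (\<eta> powr p j)"
        by (auto simp: eventually_sequentially)
    qed (use pj in auto)
    then show ?thesis by blast
  qed
  have fin_diff: "\<exists>k. lp_integral (p j) \<Omega> (\<lambda>z. f z - \<sigma> k z) < top" for j
    using tail[of 1 j] by (metis ennreal_less_top infinity_ennreal_def le_less_trans order_refl zero_less_one)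
  have fin: "lp_integral (p j) \<Omega> f < top" for j
  proof -
    obtain k where k: "lp_integral (p j) \<Omega> (\<lambda>z. f z - \<sigma> k z) < top"
      using fin_diff by blast
    have "lp_integral (p j) \<Omega> (\<lambda>z. (f z - \<sigma> k z) + \<sigma> k z) < top"
      using p_gt_1[of j] k f_meas X_measurable[OF \<sigma>X[of k]] X_finite_p[OF \<sigma>X[of k]]
      by (intro lp_integral_add_finite) auto
    then show ?thesis by simp
  qed
  have fX: "f \<in> X"
  proof (rule X_I)
    fix r :: real assume r: "1 \<le> r" "ereal r < q"
    \<comment> \<open>A general exponent \<open>r\<close> below \<open>q\<close> is dominated by
      some \<open>p j\<close>, at the price of the constant 1 in the integrand, which is integrable
      because \<open>\<Omega>\<close> is bounded.\<close>
    obtain j where j: "r \<le> p j" using p_cofinal r by blast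
    have "lp_integral r \<Omega> f \<le> (\<integral>\<^sup>+z. indicator \<Omega> z + ennreal (cmod (f z) powr p j) * indicator \<Omega> z \<partial>lborel)"
      unfolding lp_integral_def
    proof (intro nn_integral_mono)
      fix z
      have "cmod (f z) powr r \<le> 1 + cmod (f z) powr p j"
      proof (cases "cmod (f z) \<le> 1")
        case True
        then have "cmod (f z) powr r \<le> 1 powr r"
          using r by (intro powr_mono2) auto
        then show ?thesis by (simp add: add_increasing2)
      next
        case False
        then have "cmod (f z) powr r \<le> cmod (f z) powr p j"
          using j by (intro powr_mono) auto
        then show ?thesis by simp
      qed
      then have "ennreal (cmod (f z) powr r) \<le> 1 + ennreal (cmod (f z) powr p j)"
        by (metis ennreal_1 ennreal_leI ennreal_plus powr_ge_zero zero_le_one)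
      then show "ennreal (cmod (f z) powr r) * indicator \<Omega> z
          \<le> indicator \<Omega> z + ennreal (cmod (f z) powr p j) * indicator \<Omega> z"
        by (auto split: split_indicator)
    qed
    also have "\<dots> = emeasure lborel \<Omega> + lp_integral (p j) \<Omega> f"
      unfolding lp_integral_def using f_meas open_\<Omega>
      by (subst nn_integral_add) (auto intro!: borel_measurable_lp_integrand)
    also have "\<dots> < top"
      using fin[of j] emeasure_bounded_finite[OF bounded_\<Omega>] by simp
    finally show "lp_integral r \<Omega> f < top" .
  qed (use f_hol f_out in auto)
  have "(\<lambda>k. d f (\<sigma> k)) \<longlonglongrightarrow> 0"
  proof (rule d_tendsto_0, rule tendstoI)
    fix j and \<eta> :: real assume \<eta>: "0 < \<eta>"
    obtain K where K: "\<forall>k\<ge>K. lp_integral (p j) \<Omega> (\<lambda>z. f z - \<sigma> k z) \<le> ennreal ((\<eta> / 2) powr p j)"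
      using tail[of "\<eta> / 2" j] \<eta> by auto
    have "N j (\<lambda>z. f z - \<sigma> k z) < \<eta>" if "k \<ge> K" for k
    proof -
      have "lp_integral (p j) \<Omega> (\<lambda>z. f z - \<sigma> k z) \<le> ennreal ((\<eta> / 2) powr p j)"
        using K that by blast
      then have "N j (\<lambda>z. f z - \<sigma> k z) \<le> \<eta> / 2"
        using p_gt_1[of j] \<eta> fX \<sigma>X[of k]
        by (subst (asm) lp_integral_le_iff_lp_norm_le) (auto simp: X_diff X_finite_p)
      then show ?thesis using \<eta> by simp
    qed
    then show "\<forall>\<^sub>F k in sequentially. dist (N j (\<lambda>z. f z - \<sigma> k z)) 0 < \<eta>"
      by (auto simp: eventually_sequentially)
  qed
  then have "limitin mtopology \<sigma> f sequentially"
    unfolding limitin_metric using fX \<sigma>X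
    by (auto simp: commute[of _ f] dest: order_tendstoD(2))
  then show "\<exists>x. limitin mtopology \<sigma> x sequentially" by blast
qed

text \<open>A linear subspace of \<open>X\<close> with non-zero codimension has a dense complement; each
  functional \<open>\<Phi> i\<close> below is finite on such a subspace.\<close>
lemma residual:
  fixes \<Phi> :: "'i \<Rightarrow> (complex \<Rightarrow> complex) \<Rightarrow> ennreal"
  assumes I: "countable I"
    and lsc: "\<And>i g f C. i \<in> I \<Longrightarrow> (\<And>k::nat. g k \<in> X) \<Longrightarrow> f \<in> X \<Longrightarrow>
        (\<And>z. z \<in> \<Omega> \<Longrightarrow> (\<lambda>k. g k z) \<longlonglongrightarrow> f z) \<Longrightarrow> (\<And>k. \<Phi> i (g k) \<le> C) \<Longrightarrow> \<Phi> i f \<le> C"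
    and perturb: "\<And>i. i \<in> I \<Longrightarrow> \<exists>h\<in>X. \<forall>g\<in>X. \<forall>t. t \<noteq> 0 \<longrightarrow> \<Phi> i g = \<infinity> \<or> \<Phi> i (\<lambda>z. g z + t * h z) = \<infinity>"
  shows "ms_dense X d {g \<in> X. \<forall>i\<in>I. \<Phi> i g = \<infinity>}" "ms_gdelta X d {g \<in> X. \<forall>i\<in>I. \<Phi> i g = \<infinity>}"
proof -
  \<comment> \<open>Openness of these sets is the lower semicontinuity of \<open>\<Phi> i\<close>,
    and intersecting over \<open>n\<close> forces the value to be infinite.\<close>
  define V where "V i n = {g \<in> X. of_nat n < \<Phi> i g}" for i and n :: nat
  have V_open: "ms_open X d (V i n)" if i: "i \<in> I" for i n
    unfolding ms_open_def
  proof (intro conjI ballI)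
    fix f assume f: "f \<in> V i n"
    show "\<exists>e>0. \<forall>g\<in>X. d f g < e \<longrightarrow> g \<in> V i n"
    proof (rule ccontr)
      assume "\<not> ?thesis"
      then have "\<exists>g\<in>X. d f g < inverse (of_nat (Suc k)) \<and> g \<notin> V i n" for k :: nat
        by (metis inverse_positive_iff_positive of_nat_0_less_iff zero_less_Suc)
      then obtain g where g: "\<And>k. g k \<in> X" "\<And>k. d f (g k) < inverse (of_nat (Suc k))" "\<And>k. g k \<notin> V i n"
        by metis
      have "(\<lambda>k. d f (g k)) \<longlonglongrightarrow> 0"
      proof (rule tendsto_sandwich[OF _ _ tendsto_const LIMSEQ_inverse_real_of_nat])
        show "\<forall>\<^sub>F k in sequentially. d f (g k) \<le> inverse (real (Suc k))"
          using g(2) by (intro always_eventually allI less_imp_le)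
      qed simp
      then have "(\<lambda>k. g k z) \<longlonglongrightarrow> f z" if "z \<in> \<Omega>" for z
        using pointwise_convergence[of g f] g f that by (auto simp: V_def)
      moreover have "\<Phi> i (g k) \<le> of_nat n" for k
        using g(1,3)[of k] by (auto simp: V_def)
      ultimately have "\<Phi> i f \<le> of_nat n"
        using lsc[OF i, of g f] g f by (auto simp: V_def)
      then show False using f by (auto simp: V_def)
    qed
  qed (auto simp: V_def)
  have V_dense: "mtopology closure_of (V i n) = X" if i: "i \<in> I" for i n
  proof
    show "mtopology closure_of (V i n) \<subseteq> X"
      using closure_of_subset_topspace by fastforce
    show "X \<subseteq> mtopology closure_of (V i n)"
    proof
      fix f assume f: "f \<in> X"
      obtain h where h: "h \<in> X" "\<And>g t. g \<in> X \<Longrightarrow> t \<noteq> 0 \<Longrightarrow> \<Phi> i g = \<infinity> \<or> \<Phi> i (\<lambda>z. g z + t * h z) = \<infinity>"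
        using perturb[OF i] by blast
      define g where "g k = (\<lambda>z. f z + of_real (inverse (of_nat (Suc k))) * h z)" for k
      have gX: "g k \<in> X" for k
        unfolding g_def using f h by (intro X_add_scale)
      have "(\<lambda>k. d f (g k)) \<longlonglongrightarrow> 0"
      proof (rule d_tendsto_0)
        fix j
        have "N j (\<lambda>z. f z - g k z) = inverse (of_nat (Suc k)) * N j h" for k
        proof -
          have "N j (\<lambda>z. f z - g k z) = N j (\<lambda>z. - of_real (inverse (of_nat (Suc k))) * h z)"
            by (simp add: g_def)
          also have "\<dots> = cmod (- of_real (inverse (of_nat (Suc k)))) * N j h"
            using h by (intro N_scale)
          finally show ?thesis by (simp only: norm_minus_cancel norm_of_real abs_inverse abs_of_nat)
        qed
        then show "(\<lambda>k. N j (\<lambda>z. f z - g k z)) \<longlonglongrightarrow> 0"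
          using tendsto_mult_left_zero[OF LIMSEQ_inverse_real_of_nat, of "N j h"] by simp
      qed
      then have near: "\<exists>k. d f (g k) < e" if "0 < e" for e :: real
        using order_tendstoD(2)[of _ 0 sequentially e] that by (auto simp: eventually_sequentially)
      have "\<exists>y\<in>V i n. d f y < e" if "0 < e" for e
      proof (cases "\<Phi> i f = \<infinity>")
        case True
        then have "f \<in> V i n" using f by (simp add: V_def of_nat_less_top)
        then show ?thesis using that f by (intro bexI[of _ f]) auto
      next
        case False
        obtain k where k: "d f (g k) < e" using near[OF \<open>0 < e\<close>] by blast
        have "\<Phi> i (g k) = \<infinity>"
          using h(2)[OF f, of "of_real (inverse (of_nat (Suc k)))"] False
          unfolding g_def by (simp del: of_nat_Suc)
        then have "g k \<in> V i n" using gX by (simp add: V_def of_nat_less_top)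
        then show ?thesis using k by blast
      qed
      then show "f \<in> mtopology closure_of (V i n)"
        using f by (force simp: metric_closure_of V_def)
    qed
  qed
  define \<G> where "\<G> = (\<lambda>(i, n). V i n) ` (I \<times> UNIV)"
  have \<G>_countable: "countable \<G>"
    unfolding \<G>_def using I by auto
  have A_eq: "{g \<in> X. \<forall>i\<in>I. \<Phi> i g = \<infinity>} = X \<inter> \<Inter>\<G>"
  proof -
    have "\<Phi> i g = \<infinity>" if "\<And>n. of_nat n < \<Phi> i g" for i g
      using that by (metis ennreal_Ex_less_of_nat infinity_ennreal_def less_asym less_top)
    then show ?thesis
      by (fastforce simp: \<G>_def V_def of_nat_less_top)
  qed
  have "mtopology closure_of \<Inter>\<G> = X"
  proof (rule metric_Baire_category[OF complete \<G>_countable])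
    fix T assume "T \<in> \<G>"
    then obtain i n where i: "i \<in> I" "T = V i n" by (auto simp: \<G>_def)
    have "openin mtopology (V i n)"
      using V_open[OF i(1), of n] unfolding ms_open_def openin_mtopology mball_def by blast
    then show "openin mtopology T \<and> mtopology closure_of T = X"
      using V_dense i by simp
  qed
  then have dense: "\<exists>g\<in>\<Inter>\<G>. g \<in> X \<and> d f g < e" if "f \<in> X" "0 < e" for f e
  proof -
    have "f \<in> mtopology closure_of \<Inter>\<G>"
      using that \<open>mtopology closure_of \<Inter>\<G> = X\<close> by simp
    then show ?thesis
      using that by (auto simp: metric_closure_of)
  qed
  show "ms_dense X d {g \<in> X. \<forall>i\<in>I. \<Phi> i g = \<infinity>}"
    unfolding A_eq ms_dense_def using dense by fast
  \<comment> \<open>\<open>X\<close> itself joins the family so that it is nonempty, and its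
    intersection stays inside \<open>X\<close>, even when \<open>I\<close> is empty.\<close>
  have X_open: "ms_open X d X"
    unfolding ms_open_def by (auto intro: exI[of _ 1])
  have "countable (insert X \<G>)" "insert X \<G> \<noteq> {}"
    using \<G>_countable by auto
  then obtain U :: "nat \<Rightarrow> (complex \<Rightarrow> complex) set" where U: "range U = insert X \<G>"
    by (metis range_from_nat_into)
  have "ms_open X d (U n)" for n
  proof -
    have "U n \<in> insert X \<G>" using U by blast
    then show ?thesis using X_open V_open by (auto simp: \<G>_def)
  qed
  moreover have "{g \<in> X. \<forall>i\<in>I. \<Phi> i g = \<infinity>} = (\<Inter>n. U n)"
    unfolding A_eq U by auto
  ultimately show "ms_gdelta X d {g \<in> X. \<forall>i\<in>I. \<Phi> i g = \<infinity>}"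
    unfolding ms_gdelta_def by blast
qed

end

section \<open>Functions blowing up at a boundary point\<close>

lemma holomorphic_primitive_if_loop_integrals_zero:
  fixes f :: "complex \<Rightarrow> complex"
  assumes S: "open S" "connected S" and f: "f holomorphic_on S"
    and loops: "\<And>\<gamma>. valid_path \<gamma> \<Longrightarrow> path_image \<gamma> \<subseteq> S \<Longrightarrow> pathfinish \<gamma> = pathstart \<gamma> \<Longrightarrow> contour_integral \<gamma> f = 0"
  obtains F where "\<And>z. z \<in> S \<Longrightarrow> (F has_field_derivative f z) (at z)"
proof (cases "S = {}")
  case False
  then obtain b where b: "b \<in> S" by blast
  have "\<exists>\<gamma>. valid_path \<gamma> \<and> path_image \<gamma> \<subseteq> S \<and> pathstart \<gamma> = b \<and> pathfinish \<gamma> = z" if "z \<in> S" for z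
    using connected_open_polynomial_connected[OF S b that] valid_path_polynomial_function by blast
  then obtain \<gamma> where \<gamma>: "\<And>z. z \<in> S \<Longrightarrow>
      valid_path (\<gamma> z) \<and> path_image (\<gamma> z) \<subseteq> S \<and> pathstart (\<gamma> z) = b \<and> pathfinish (\<gamma> z) = z"
    by metis
  define F where "F z = contour_integral (\<gamma> z) f" for z
  have "(F has_field_derivative f x) (at x)" if x: "x \<in> S" for x
  proof -
    obtain e where e: "0 < e" "ball x e \<subseteq> S"
      using S(1) x open_contains_ball by blast
    have fB: "f holomorphic_on ball x e"
      using f e(2) by (rule holomorphic_on_subset)
    obtain H where H: "\<And>y. y \<in> ball x e \<Longrightarrow> (H has_field_derivative f y) (at y within ball x e)"
      using holomorphic_convex_primitive'[OF _ _ fB] by auto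
    \<comment> \<open>The path from \<open>b\<close> to each point is an arbitrary choice. Closing
      the chosen paths to \<open>x\<close> and \<open>y\<close> by the segment between them gives a
      loop, so on this ball \<open>F\<close> differs from the local primitive \<open>H\<close> by a
      constant.\<close>
    have F_eq: "F y = F x + (H y - H x)" if y: "y \<in> ball x e" for y
    proof -
      have yS: "y \<in> S" using y e by blast
      have seg: "closed_segment x y \<subseteq> ball x e"
        using y e(1) by (intro closed_segment_subset) auto
      have int: "f contour_integrable_on \<gamma> x" "f contour_integrable_on \<gamma> y"
          "f contour_integrable_on linepath x y"
        using contour_integrable_holomorphic_simple[OF f S(1)] \<gamma>[OF x] \<gamma>[OF yS] seg e(2) by auto
      let ?l = "\<gamma> x +++ linepath x y +++ reversepath (\<gamma> y)"
      have "contour_integral ?l f = 0"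
        using \<gamma>[OF x] \<gamma>[OF yS] seg e(2)
        by (intro loops) (auto intro!: valid_path_join simp: path_image_join valid_path_reversepath)
      moreover have "contour_integral ?l f = F x + (contour_integral (linepath x y) f - F y)"
        using \<gamma>[OF x] \<gamma>[OF yS] int
        by (simp add: F_def contour_integral_reversepath contour_integrable_reversepath valid_path_reversepath)
      moreover have "contour_integral (linepath x y) f = H y - H x"
        using contour_integral_primitive[of "ball x e" H f "linepath x y"] H seg
        by (simp add: contour_integral_unique)
      ultimately show ?thesis by (simp add: algebra_simps)
    qed
    have "((\<lambda>y. F x + (H y - H x)) has_field_derivative f x) (at x)"
      using H[of x] e(1) by (auto intro!: derivative_eq_intros simp: at_within_open[of x "ball x e"])
    then show ?thesis
    proof (rule has_field_derivative_transform_within_open)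
      show "F x + (H y - H x) = F y" if "y \<in> ball x e" for y
        using F_eq[OF that] ..
    qed (use e in auto)
  qed
  then show ?thesis by (rule that)
qed (use that in auto)

text \<open>The logarithmic derivative of the quotient has a primitive because its integral over a
  loop is \<open>2 * pi * \<i>\<close> times the difference of the winding numbers around
  \<open>\<zeta>\<close> and \<open>a\<close>. These agree, since \<open>C\<close> is connected,
  contains both points and misses the loop.\<close>

lemma holomorphic_log_quotient_connected:
  assumes S: "open S" "connected S" and C: "connected C" "\<zeta> \<in> C" "a \<in> C" "C \<inter> S = {}"
  obtains L where "L holomorphic_on S" "\<And>z. z \<in> S \<Longrightarrow> exp (L z) = (z - \<zeta>) / (z - a)"
proof (cases "S = {}")
  case False
  then obtain b where b: "b \<in> S" by blast
  have ne: "z \<noteq> \<zeta>" "z \<noteq> a" if "z \<in> S" for z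
    using that C by auto
  define f where "f z = 1 / (z - \<zeta>) - 1 / (z - a)" for z
  have f_hol: "f holomorphic_on S"
    unfolding f_def using ne by (auto intro!: holomorphic_intros)
  have "contour_integral \<gamma> f = 0"
    if \<gamma>: "valid_path \<gamma>" "path_image \<gamma> \<subseteq> S" "pathfinish \<gamma> = pathstart \<gamma>" for \<gamma>
  proof -
    have notin: "\<zeta> \<notin> path_image \<gamma>" "a \<notin> path_image \<gamma>"
      using C \<gamma>(2) by auto
    have "winding_number \<gamma> \<zeta> = winding_number \<gamma> a"
      using C \<gamma> by (intro winding_number_eq[of \<gamma> \<zeta> C a] valid_path_imp_path) auto
    moreover have "((\<lambda>z. 1 / (z - \<zeta>)) has_contour_integral 2 * pi * \<i> * winding_number \<gamma> \<zeta>) \<gamma>"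
      using \<gamma>(1) notin by (intro has_contour_integral_winding_number) auto
    moreover have "((\<lambda>z. 1 / (z - a)) has_contour_integral 2 * pi * \<i> * winding_number \<gamma> a) \<gamma>"
      using \<gamma>(1) notin by (intro has_contour_integral_winding_number) auto
    ultimately have "(f has_contour_integral 0) \<gamma>"
      unfolding f_def using has_contour_integral_diff by fastforce
    then show ?thesis by (rule contour_integral_unique)
  qed
  then obtain F where F: "\<And>z. z \<in> S \<Longrightarrow> (F has_field_derivative f z) (at z)"
    using holomorphic_primitive_if_loop_integrals_zero[OF S f_hol] by metis
  \<comment> \<open>The additive constant makes \<open>exp (L b)\<close> the value of the quotient
    at \<open>b\<close>. The function \<open>k\<close> below has derivative 0 and is therefore
    constantly 1.\<close>
  define L where "L z = F z - F b + Ln ((b - \<zeta>) / (b - a))" for z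
  have L: "(L has_field_derivative f z) (at z)" if "z \<in> S" for z
    unfolding L_def by (auto intro!: derivative_eq_intros F that)
  define k where "k z = exp (- L z) * ((z - \<zeta>) / (z - a))" for z
  have "(k has_field_derivative 0) (at z)" if z: "z \<in> S" for z
  proof -
    have "((\<lambda>z. (z - \<zeta>) / (z - a)) has_field_derivative f z * ((z - \<zeta>) / (z - a))) (at z)"
      using ne[OF z] by (auto intro!: derivative_eq_intros simp: f_def divide_simps)
    moreover have "((\<lambda>z. exp (- L z)) has_field_derivative - f z * exp (- L z)) (at z)"
      by (auto intro!: derivative_eq_intros L z)
    ultimately have "(k has_field_derivative (- f z * exp (- L z)) * ((z - \<zeta>) / (z - a))
        + (f z * ((z - \<zeta>) / (z - a))) * exp (- L z)) (at z)"
      unfolding k_def by (rule DERIV_mult[rotated])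
    then show ?thesis by (simp add: mult.commute mult.left_commute)
  qed
  then have "k z = k b" if "z \<in> S" for z
    by (intro has_derivative_zero_unique_connected[OF S _ that b])
      (simp add: has_field_derivative_def lambda_zero)
  moreover have "k b = 1"
    using ne[OF b] by (simp add: k_def L_def exp_minus)
  ultimately have "exp (L z) = (z - \<zeta>) / (z - a)" if "z \<in> S" for z
  proof -
    have "exp (- L z) * ((z - \<zeta>) / (z - a)) = 1"
      using \<open>k b = 1\<close> \<open>\<And>z. z \<in> S \<Longrightarrow> k z = k b\<close>[OF that] by (simp only: k_def)
    then have "exp (L z) * exp (- L z) * ((z - \<zeta>) / (z - a)) = exp (L z)"
      by (simp only: mult.assoc mult_1_right)
    then show ?thesis
      by (simp only: exp_minus_inverse mult_1_left)
  qed
  moreover have "L holomorphic_on S"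
    using L S(1) by (auto simp: holomorphic_on_open)
  ultimately show ?thesis by (intro that[of L])
qed (use that[of "\<lambda>z. 0"] in auto)

text \<open>\<open>\<Omega>\<close> need not be connected: its components are open and disjoint, so
  independent choices on them paste to a holomorphic function.\<close>

lemma holomorphic_log_quotient:
  assumes \<Omega>: "open \<Omega>" and C: "connected C" "\<zeta> \<in> C" "a \<in> C" "C \<inter> \<Omega> = {}"
  obtains L where "L holomorphic_on \<Omega>" "\<And>z. z \<in> \<Omega> \<Longrightarrow> exp (L z) = (z - \<zeta>) / (z - a)"
proof -
  have "\<exists>L. L holomorphic_on S \<and> (\<forall>z\<in>S. exp (L z) = (z - \<zeta>) / (z - a))" if S: "S \<in> components \<Omega>" for S
  proof -
    have S': "open S" "connected S" "C \<inter> S = {}"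
      using S \<Omega> C(4) open_components in_components_connected in_components_subset by blast+
    obtain L where "L holomorphic_on S" "\<And>z. z \<in> S \<Longrightarrow> exp (L z) = (z - \<zeta>) / (z - a)"
      using holomorphic_log_quotient_connected[OF S'(1,2) C(1-3) S'(3)] by metis
    then show ?thesis by blast
  qed
  then obtain F where F: "\<And>S. S \<in> components \<Omega> \<Longrightarrow> F S holomorphic_on S"
      "\<And>S z. S \<in> components \<Omega> \<Longrightarrow> z \<in> S \<Longrightarrow> exp (F S z) = (z - \<zeta>) / (z - a)"
    by metis
  define L where "L z = F (connected_component_set \<Omega> z) z" for z
  have comp: "connected_component_set \<Omega> z = S" if "S \<in> components \<Omega>" "z \<in> S" for S z
    using that by (metis componentsE connected_component_eq)
  have "L holomorphic_on (\<Union>S\<in>components \<Omega>. S)"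
  proof (rule holomorphic_on_UN_open)
    fix S assume S: "S \<in> components \<Omega>"
    show "L holomorphic_on S"
      using F(1)[OF S] by (rule holomorphic_transform) (use comp[OF S] in \<open>simp add: L_def\<close>)
    show "open S" using S \<Omega> open_components by blast
  qed
  then have "L holomorphic_on \<Omega>"
    using Union_components[of \<Omega>] by simp
  moreover have "exp (L z) = (z - \<zeta>) / (z - a)" if "z \<in> \<Omega>" for z
    using that F(2)[of "connected_component_set \<Omega> z" z] by (simp add: L_def componentsI)
  ultimately show ?thesis by (intro that[of L])
qed

lemma exists_holomorphic_with_power_modulus:
  assumes \<Omega>: "open \<Omega>" and C: "connected C" "\<zeta> \<in> C" "a \<in> C" "C \<inter> \<Omega> = {}"
  obtains f where "f holomorphic_on \<Omega>" "\<And>z. z \<notin> \<Omega> \<Longrightarrow> f z = 0"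
    "\<And>z. z \<in> \<Omega> \<Longrightarrow> cmod (f z) = (cmod (z - a) / cmod (z - \<zeta>)) powr \<alpha>"
proof -
  obtain L where L: "L holomorphic_on \<Omega>" "\<And>z. z \<in> \<Omega> \<Longrightarrow> exp (L z) = (z - \<zeta>) / (z - a)"
    using holomorphic_log_quotient[OF assms] by metis
  define f where "f z = (if z \<in> \<Omega> then exp (- of_real \<alpha> * L z) else 0)" for z
  have "(\<lambda>z. exp (- of_real \<alpha> * L z)) holomorphic_on \<Omega>"
    by (intro holomorphic_intros L)
  then have "f holomorphic_on \<Omega>"
    by (rule holomorphic_transform) (simp add: f_def)
  moreover have "cmod (f z) = (cmod (z - a) / cmod (z - \<zeta>)) powr \<alpha>" if z: "z \<in> \<Omega>" for z
  proof -
    have ne: "z \<noteq> \<zeta>" "z \<noteq> a" using z C by auto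
    have "exp (Re (L z)) = cmod (z - \<zeta>) / cmod (z - a)"
      using L(2)[OF z] by (metis norm_divide norm_exp_eq_Re)
    then have "Re (L z) = ln (cmod (z - \<zeta>) / cmod (z - a))"
      by (metis ln_exp)
    then have "- Re (L z) = ln (cmod (z - a) / cmod (z - \<zeta>))"
      using ne by (simp add: ln_div)
    moreover have "cmod (f z) = exp (\<alpha> * (- Re (L z)))"
      using z by (simp add: f_def)
    ultimately have "cmod (f z) = exp (\<alpha> * ln (cmod (z - a) / cmod (z - \<zeta>)))"
      by simp
    moreover have "cmod (z - a) / cmod (z - \<zeta>) \<noteq> 0"
      using ne by simp
    ultimately show ?thesis
      by (simp only: powr_def if_False)
  qed
  ultimately show ?thesis by (intro that[of f]) (simp_all add: f_def)
qed

text \<open>Two centres are allowed because the logarithm of the quotient may be singular at both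
  \<open>\<zeta>\<close> and \<open>a\<close>; the other applications take the same point twice.
  Integrating the bound over a ball around \<open>D\<close> keeps the dominating functions
  measurable.\<close>

lemma lp_integral_finite_if_bounded_by_powers:
  assumes D: "bounded D" and \<beta>: "0 < \<beta>" "\<beta> < 2"
    and bound: "\<And>z. z \<in> D \<Longrightarrow> cmod (f z) powr r \<le> C * (cmod (z - \<zeta>) powr - \<beta> + cmod (z - a) powr - \<beta>)"
  shows "lp_integral r D f < top"
proof -
  obtain R where R: "D \<subseteq> ball 0 R"
    using D bounded_subset_ballD by blast
  let ?k = "\<lambda>c z. ennreal (cmod (z - c) powr - \<beta>) * indicator (ball 0 R) z"
  have fin: "(\<integral>\<^sup>+z. ?k c z \<partial>lborel) < top" for c
    using nn_integral_norm_powr_finite[OF \<beta>, of "ball 0 R" c] by simp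
  have meas: "?k c \<in> borel_measurable borel" for c
    by (intro borel_measurable_lp_integrand[of "\<lambda>z. z - c"]) auto
  have "lp_integral r D f \<le> (\<integral>\<^sup>+z. ennreal \<bar>C\<bar> * (?k \<zeta> z + ?k a z) \<partial>lborel)"
    unfolding lp_integral_def
  proof (intro nn_integral_mono)
    fix z
    show "ennreal (cmod (f z) powr r) * indicator D z \<le> ennreal \<bar>C\<bar> * (?k \<zeta> z + ?k a z)"
    proof (cases "z \<in> D")
      case True
      have "cmod (f z) powr r \<le> \<bar>C\<bar> * (cmod (z - \<zeta>) powr - \<beta> + cmod (z - a) powr - \<beta>)"
        using bound[OF True] by (rule order_trans) (intro mult_right_mono, auto)
      moreover have "z \<in> ball 0 R" using True R by blast
      ultimately show ?thesis
        using True by (simp add: ennreal_leI flip: ennreal_mult ennreal_plus)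
    qed simp
  qed
  also have "\<dots> = ennreal \<bar>C\<bar> * ((\<integral>\<^sup>+z. ?k \<zeta> z \<partial>lborel) + (\<integral>\<^sup>+z. ?k a z \<partial>lborel))"
    using meas by (subst nn_integral_cmult) (auto simp: nn_integral_add)
  also have "\<dots> < top"
    using fin by (simp add: ennreal_mult_less_top)
  finally show ?thesis .
qed

text \<open>The limit is taken along all of \<open>\<Omega>\<close>, so \<open>f\<close> is
  unbounded on every subset of \<open>\<Omega>\<close> whose closure contains
  \<open>\<zeta>\<close>, whichever component it belongs to.\<close>

definition blows_up_at :: "(complex \<Rightarrow> complex) \<Rightarrow> complex set \<Rightarrow> complex \<Rightarrow> bool" where
  "blows_up_at f \<Omega> \<zeta> \<longleftrightarrow> (\<forall>M. \<exists>e>0. \<forall>z\<in>\<Omega> \<inter> ball \<zeta> e. M < cmod (f z))"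

lemma blows_up_atI:
  assumes lim: "filterlim (\<lambda>z. cmod (f z)) at_top (at \<zeta> within \<Omega>)" and \<zeta>: "\<zeta> \<notin> \<Omega>"
  shows "blows_up_at f \<Omega> \<zeta>"
  unfolding blows_up_at_def
proof
  fix M
  have "\<forall>\<^sub>F z in at \<zeta> within \<Omega>. M < cmod (f z)"
    using lim by (simp add: filterlim_at_top_dense)
  then obtain e where "e > 0" "\<forall>z\<in>\<Omega>. z \<noteq> \<zeta> \<and> dist z \<zeta> < e \<longrightarrow> M < cmod (f z)"
    unfolding eventually_at by blast
  then show "\<exists>e>0. \<forall>z\<in>\<Omega> \<inter> ball \<zeta> e. M < cmod (f z)"
    using \<zeta> by (intro exI[of _ e]) (auto simp: dist_commute)
qed

section \<open>Peak functions: a pole, a fractional power and a logarithm\<close>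

lemma filterlim_powr_at_top:
  fixes \<alpha> :: real
  assumes "0 < \<alpha>"
  shows "filterlim (\<lambda>x. x powr \<alpha>) at_top at_top"
proof -
  have "filterlim (\<lambda>x. exp (\<alpha> * ln x)) at_top at_top"
    using assms
    by (intro filterlim_compose[OF exp_at_top] filterlim_tendsto_pos_mult_at_top[OF tendsto_const] ln_at_top)
  moreover have "\<forall>\<^sub>F x in at_top. exp (\<alpha> * ln x) \<le> x powr \<alpha>"
    using eventually_gt_at_top[of 0] by eventually_elim (simp add: powr_def)
  ultimately show ?thesis
    by (rule filterlim_at_top_mono)
qed

lemma filterlim_norm_diff_at_right:
  fixes \<zeta> :: complex
  shows "filterlim (\<lambda>z. cmod (z - \<zeta>)) (at_right 0) (at \<zeta> within \<Omega>)"
  unfolding filterlim_at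
proof
  have "((\<lambda>z. cmod (z - \<zeta>)) \<longlongrightarrow> cmod (\<zeta> - \<zeta>)) (at \<zeta> within \<Omega>)"
    by (intro tendsto_intros)
  then show "((\<lambda>z. cmod (z - \<zeta>)) \<longlongrightarrow> 0) (at \<zeta> within \<Omega>)" by simp
  show "\<forall>\<^sub>F z in at \<zeta> within \<Omega>. cmod (z - \<zeta>) \<in> {0<..} \<and> cmod (z - \<zeta>) \<noteq> 0"
    by (auto simp: eventually_at intro!: exI[of _ 1])
qed

lemma pole_in_OLbelow:
  assumes \<Omega>: "open \<Omega>" "bounded \<Omega>" and \<zeta>: "\<zeta> \<notin> \<Omega>"
  shows "\<exists>f\<in>OLbelow 2 \<Omega>. blows_up_at f \<Omega> \<zeta>"
proof (intro bexI)
  define f where "f z = (if z \<in> \<Omega> then 1 / (z - \<zeta>) else 0)" for z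
  have "(\<lambda>z. 1 / (z - \<zeta>)) holomorphic_on \<Omega>"
    using \<zeta> by (auto intro!: holomorphic_intros)
  then have "f holomorphic_on \<Omega>"
    by (rule holomorphic_transform) (simp add: f_def)
  moreover have "lp_integral r \<Omega> f < top" if r: "1 \<le> r" "ereal r < 2" for r
  proof (rule lp_integral_finite_if_bounded_by_powers[OF \<Omega>(2)])
    have "(2::ereal) = ereal 2" by simp
    then show "0 < r" "r < 2" using r by auto
    show "cmod (f z) powr r \<le> 1 * (cmod (z - \<zeta>) powr - r + cmod (z - \<zeta>) powr - r)" if "z \<in> \<Omega>" for z
      using that by (simp add: f_def norm_divide powr_divide powr_minus_divide divide_right_mono)
  qed
  ultimately show "f \<in> OLbelow 2 \<Omega>"
    by (simp add: OLbelow_def OLp_def f_def)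
  show "blows_up_at f \<Omega> \<zeta>"
  proof (rule blows_up_atI[OF _ \<zeta>])
    have "filterlim (\<lambda>z. inverse (cmod (z - \<zeta>))) at_top (at \<zeta> within \<Omega>)"
      by (rule filterlim_compose[OF filterlim_inverse_at_top_right filterlim_norm_diff_at_right])
    moreover have "\<forall>\<^sub>F z in at \<zeta> within \<Omega>. inverse (cmod (z - \<zeta>)) = cmod (f z)"
      by (auto simp: eventually_at f_def norm_divide inverse_eq_divide intro!: exI[of _ 1])
    ultimately show "filterlim (\<lambda>z. cmod (f z)) at_top (at \<zeta> within \<Omega>)"
      using filterlim_cong[OF refl refl] by fastforce
  qed
qed

text \<open>With \<open>\<alpha> = 2 / q\<close> the exponent \<open>\<alpha> * r\<close> of the
  singularity is below the critical value 2 exactly for \<open>r < q\<close>. At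
  \<open>r = q\<close> it equals 2, which gives the lower bound from which non-integrability on
  cones will follow.\<close>

lemma power_peak_in_OLbelow:
  assumes \<Omega>: "open \<Omega>" "bounded \<Omega>" and C: "connected C" "\<zeta> \<in> C" "a \<in> C" "C \<inter> \<Omega> = {}" "a \<noteq> \<zeta>"
    and q: "1 < q"
  obtains f c e where "f \<in> OLbelow (ereal q) \<Omega>" "blows_up_at f \<Omega> \<zeta>" "0 < c" "0 < e"
    "\<And>z. z \<in> \<Omega> \<inter> ball \<zeta> e \<Longrightarrow> c * cmod (z - \<zeta>) powr - 2 \<le> cmod (f z) powr q"
proof -
  define \<alpha> where "\<alpha> = 2 / q"
  have \<alpha>: "0 < \<alpha>" using q by (simp add: \<alpha>_def)
  have \<zeta>: "\<zeta> \<notin> \<Omega>" using C by blast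
  obtain f where f: "f holomorphic_on \<Omega>" "\<And>z. z \<notin> \<Omega> \<Longrightarrow> f z = 0"
    "\<And>z. z \<in> \<Omega> \<Longrightarrow> cmod (f z) = (cmod (z - a) / cmod (z - \<zeta>)) powr \<alpha>"
    using exists_holomorphic_with_power_modulus[OF \<Omega>(1) C(1-4)] by metis
  have f_powr: "cmod (f z) powr r = cmod (z - a) powr (\<alpha> * r) * cmod (z - \<zeta>) powr - (\<alpha> * r)" if "z \<in> \<Omega>" for z r
    using that by (simp add: f(3) powr_powr powr_divide powr_minus_divide)
  obtain R where R: "0 < R" "\<Omega> \<subseteq> ball a R"
    using bounded_subset_ballD[OF \<Omega>(2)] by blast
  have "lp_integral r \<Omega> f < top" if r: "1 \<le> r" "ereal r < ereal q" for r
  proof (rule lp_integral_finite_if_bounded_by_powers[OF \<Omega>(2)])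
    show "0 < \<alpha> * r" "\<alpha> * r < 2" using r q by (auto simp: \<alpha>_def field_simps)
    show "cmod (f z) powr r \<le> R powr (\<alpha> * r) * (cmod (z - \<zeta>) powr - (\<alpha> * r) + cmod (z - \<zeta>) powr - (\<alpha> * r))"
      if z: "z \<in> \<Omega>" for z
    proof -
      have "cmod (z - a) < R" using R z by (auto simp: dist_norm norm_minus_commute subset_iff)
      then have "cmod (f z) powr r \<le> R powr (\<alpha> * r) * cmod (z - \<zeta>) powr - (\<alpha> * r)"
        unfolding f_powr[OF z] using \<alpha> r by (intro mult_right_mono powr_mono2) auto
      also have "\<dots> \<le> R powr (\<alpha> * r) * (cmod (z - \<zeta>) powr - (\<alpha> * r) + cmod (z - \<zeta>) powr - (\<alpha> * r))"
        by (intro mult_left_mono) auto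
      finally show ?thesis .
    qed
  qed
  then have fX: "f \<in> OLbelow (ereal q) \<Omega>"
    using f by (simp add: OLbelow_def OLp_def)
  \<comment> \<open>So close to \<open>\<zeta>\<close> the distance to \<open>a\<close> is at least
    \<open>e\<close>, and the zero of the numerator cannot weaken the singularity.\<close>
  define e where "e = cmod (a - \<zeta>) / 2"
  have e: "0 < e" using C(5) by (simp add: e_def)
  have far: "e \<le> cmod (z - a)" if "z \<in> ball \<zeta> e" for z
    using that norm_triangle_ineq[of "a - z" "z - \<zeta>"] by (simp add: e_def dist_norm norm_minus_commute)
  have peak: "e powr 2 * cmod (z - \<zeta>) powr - 2 \<le> cmod (f z) powr q" if z: "z \<in> \<Omega> \<inter> ball \<zeta> e" for z
  proof -
    have "e powr 2 \<le> cmod (z - a) powr 2"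
      using far[of z] z e by (intro powr_mono2) auto
    moreover have "\<alpha> * q = 2" using q by (simp add: \<alpha>_def)
    ultimately show ?thesis
      using f_powr[of z q] z by (simp add: mult_right_mono)
  qed
  have "blows_up_at f \<Omega> \<zeta>"
  proof (rule blows_up_atI[OF _ \<zeta>])
    have "((\<lambda>z. cmod (z - a)) \<longlongrightarrow> cmod (\<zeta> - a)) (at \<zeta> within \<Omega>)"
      by (intro tendsto_intros)
    then have "filterlim (\<lambda>z. cmod (z - a) * inverse (cmod (z - \<zeta>))) at_top (at \<zeta> within \<Omega>)"
      by (rule filterlim_tendsto_pos_mult_at_top)
        (use C(5) in \<open>auto intro: filterlim_compose[OF filterlim_inverse_at_top_right filterlim_norm_diff_at_right]\<close>)
    then have "filterlim (\<lambda>z. (cmod (z - a) * inverse (cmod (z - \<zeta>))) powr \<alpha>) at_top (at \<zeta> within \<Omega>)"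
      by (rule filterlim_compose[OF filterlim_powr_at_top[OF \<alpha>]])
    moreover have "\<forall>\<^sub>F z in at \<zeta> within \<Omega>. (cmod (z - a) * inverse (cmod (z - \<zeta>))) powr \<alpha> = cmod (f z)"
      by (auto simp: eventually_at f divide_inverse intro!: exI[of _ 1])
    ultimately show "filterlim (\<lambda>z. cmod (f z)) at_top (at \<zeta> within \<Omega>)"
      using filterlim_cong[OF refl refl] by fastforce
  qed
  then show ?thesis
    using e by (intro that[OF fX _ _ e peak]) simp_all
qed

text \<open>Away from the segment the quotient avoids the nonpositive reals, so the principal branch
  is available and its imaginary part is bounded by \<open>pi\<close>. Only the logarithm of the
  modulus can be large.\<close>

lemma log_peak_in_OLbelow:
  assumes \<Omega>: "open \<Omega>" "bounded \<Omega>" and seg: "closed_segment \<zeta> a \<inter> \<Omega> = {}" and a: "a \<noteq> \<zeta>"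
  shows "\<exists>f\<in>OLbelow \<infinity> \<Omega>. blows_up_at f \<Omega> \<zeta>"
proof (intro bexI)
  define w where "w z = (z - \<zeta>) / (z - a)" for z
  define f where "f z = (if z \<in> \<Omega> then Ln (w z) else 0)" for z
  have \<zeta>: "\<zeta> \<notin> \<Omega>" and a\<Omega>: "a \<notin> \<Omega>" using seg by auto
  have ne: "z \<noteq> \<zeta>" "z \<noteq> a" "w z \<noteq> 0" if "z \<in> \<Omega>" for z
    using that \<zeta> a\<Omega> by (auto simp: w_def)
  have w_slit: "w z \<notin> \<real>\<^sub>\<le>\<^sub>0" if z: "z \<in> \<Omega>" for z
  proof
    assume "w z \<in> \<real>\<^sub>\<le>\<^sub>0"
    then obtain t where t: "w z = of_real t" "t \<le> 0"
      by (auto simp: nonpos_Reals_def)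
    \<comment> \<open>Solving \<open>w z = t\<close> for \<open>z\<close> gives a convex combination
      of \<open>\<zeta>\<close> and \<open>a\<close>; \<open>s\<close> is the weight of
      \<open>a\<close>.\<close>
    define s where "s = - t / (1 - t)"
    have s: "0 \<le> s" "s \<le> 1" "1 - s = 1 / (1 - t)"
      using t(2) by (auto simp: s_def field_simps)
    have "z - \<zeta> = of_real t * (z - a)"
      using t(1) ne[OF z] by (simp add: w_def field_simps)
    then have "z * (1 - of_real t) = \<zeta> - of_real t * a"
      by (simp add: algebra_simps)
    moreover have "1 - complex_of_real t \<noteq> 0"
      using t(2) by (metis of_real_1 of_real_diff of_real_eq_0_iff diff_gt_0_iff_gt less_irrefl order_le_less_trans zero_less_one)
    ultimately have "z = (\<zeta> - of_real t * a) / (1 - of_real t)"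
      by (simp add: field_simps)
    also have "\<dots> = (1 - s) *\<^sub>R \<zeta> + s *\<^sub>R a"
      unfolding s(3) by (simp add: s_def scaleR_conv_of_real diff_divide_distrib)
    finally have "z \<in> closed_segment \<zeta> a"
      using s by (auto simp: in_segment)
    then show False using seg z by blast
  qed
  have "(\<lambda>z. Ln (w z)) holomorphic_on \<Omega>"
    using w_slit ne unfolding w_def by (auto intro!: holomorphic_intros)
  then have "f holomorphic_on \<Omega>"
    by (rule holomorphic_transform) (simp add: f_def)
  moreover have "lp_integral r \<Omega> f < top" if r: "1 \<le> r" for r
  proof -
    obtain R1 where R1: "\<Omega> \<subseteq> ball \<zeta> R1" using bounded_subset_ballD[OF \<Omega>(2)] by blast
    obtain R2 where R2: "\<Omega> \<subseteq> ball a R2" using bounded_subset_ballD[OF \<Omega>(2)] by blast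
    define R where "R = max R1 R2"
    show ?thesis
    proof (rule lp_integral_finite_if_bounded_by_powers[OF \<Omega>(2)])
      \<comment> \<open>Singularities of order 1 suffice for every \<open>r\<close>: up to a
        constant the r-th power of the logarithm is at most
        \<open>exp \<bar>ln (cmod (w z))\<bar>\<close>, hence at most the modulus of
        \<open>w z\<close> plus its inverse.\<close>
      show "(0::real) < 1" "(1::real) < 2" by auto
      show "cmod (f z) powr r \<le> r powr r * exp pi * R * (cmod (z - \<zeta>) powr - 1 + cmod (z - a) powr - 1)"
        if z: "z \<in> \<Omega>" for z
      proof -
        have pos: "0 < cmod (z - \<zeta>)" "0 < cmod (z - a)" using ne[OF z] by auto
        have R: "cmod (z - \<zeta>) \<le> R" "cmod (z - a) \<le> R"
          using R1 R2 z unfolding R_def by (fastforce simp: dist_norm norm_minus_commute)+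
        have powr_le_exp: "x powr r \<le> r powr r * exp x" if x: "0 \<le> x" for x
        proof -
          have "x / r \<le> exp (x / r)"
            using exp_ge_add_one_self[of "x / r"] by linarith
          then have "(x / r) powr r \<le> exp (x / r) powr r"
            using x r by (intro powr_mono2) auto
          also have "\<dots> = exp x"
            using r by (simp add: powr_def)
          finally show ?thesis
            using r x by (simp add: powr_divide field_simps)
        qed
        have "cmod (f z) \<le> \<bar>ln (cmod (w z))\<bar> + pi"
        proof -
          have "cmod (Ln (w z)) \<le> \<bar>Re (Ln (w z))\<bar> + \<bar>Im (Ln (w z))\<bar>"
            by (rule cmod_le)
          moreover have "Re (Ln (w z)) = ln (cmod (w z))" using ne[OF z] by simp
          moreover have "\<bar>Im (Ln (w z))\<bar> \<le> pi"
            using mpi_less_Im_Ln[OF ne(3)[OF z]] Im_Ln_le_pi[OF ne(3)[OF z]] by linarith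
          ultimately show ?thesis using z by (simp add: f_def)
        qed
        then have "cmod (f z) powr r \<le> r powr r * exp (\<bar>ln (cmod (w z))\<bar> + pi)"
          using powr_le_exp[of "cmod (f z)"] by (smt (verit, best) exp_le_cancel_iff mult_left_mono norm_ge_zero powr_ge_zero)
        also have "exp (\<bar>ln (cmod (w z))\<bar> + pi) = exp pi * exp \<bar>ln (cmod (w z))\<bar>"
          by (simp add: exp_add)
        also have "exp \<bar>ln (cmod (w z))\<bar> \<le> cmod (w z) + inverse (cmod (w z))"
          using ne(3)[OF z] by (auto simp: abs_if exp_minus)
        also have "cmod (w z) + inverse (cmod (w z))
            = cmod (z - \<zeta>) * inverse (cmod (z - a)) + cmod (z - a) * inverse (cmod (z - \<zeta>))"
          unfolding w_def norm_divide by (simp add: divide_inverse)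
        also have "\<dots> \<le> R * inverse (cmod (z - a)) + R * inverse (cmod (z - \<zeta>))"
          using R by (intro add_mono mult_right_mono) auto
        finally have "cmod (f z) powr r \<le> r powr r * (exp pi * (R * inverse (cmod (z - a)) + R * inverse (cmod (z - \<zeta>))))"
          by (simp add: mult_left_mono)
        then show ?thesis
          using pos by (simp add: powr_minus algebra_simps)
      qed
    qed
  qed
  ultimately show "f \<in> OLbelow \<infinity> \<Omega>"
    by (simp add: OLbelow_def OLp_def f_def)
  show "blows_up_at f \<Omega> \<zeta>"
  proof (rule blows_up_atI[OF _ \<zeta>])
    have "((\<lambda>z. cmod (z - a)) \<longlongrightarrow> cmod (\<zeta> - a)) (at \<zeta> within \<Omega>)"
      by (intro tendsto_intros)
    then have "filterlim (\<lambda>z. cmod (z - a) * inverse (cmod (z - \<zeta>))) at_top (at \<zeta> within \<Omega>)"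
      by (rule filterlim_tendsto_pos_mult_at_top)
        (use a in \<open>auto intro: filterlim_compose[OF filterlim_inverse_at_top_right filterlim_norm_diff_at_right]\<close>)
    then have "filterlim (\<lambda>z. ln (cmod (z - a) * inverse (cmod (z - \<zeta>)))) at_top (at \<zeta> within \<Omega>)"
      by (rule filterlim_compose[OF ln_at_top])
    then show "filterlim (\<lambda>z. cmod (f z)) at_top (at \<zeta> within \<Omega>)"
    proof (rule filterlim_at_top_mono)
      have "ln (cmod (z - a) * inverse (cmod (z - \<zeta>))) \<le> cmod (f z)" if z: "z \<in> \<Omega>" for z
      proof -
        have "cmod (z - a) * inverse (cmod (z - \<zeta>)) = inverse (cmod (w z))"
          unfolding w_def norm_divide by (simp add: divide_inverse)
        then have "ln (cmod (z - a) * inverse (cmod (z - \<zeta>))) = - Re (Ln (w z))"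
          using ne[OF z] by (simp add: ln_inverse)
        also have "\<dots> \<le> cmod (Ln (w z))"
          using abs_Re_le_cmod[of "Ln (w z)"] by linarith
        finally show ?thesis using z by (simp add: f_def)
      qed
      then show "\<forall>\<^sub>F z in at \<zeta> within \<Omega>. ln (cmod (z - a) * inverse (cmod (z - \<zeta>))) \<le> cmod (f z)"
        by (auto simp: eventually_at intro!: exI[of _ 1])
    qed
  qed
qed

text \<open>Near \<open>\<zeta>\<close> the linear part of \<open>\<rho>\<close> dominates its
  error. The inner unit normal \<open>u\<close>, opposite to the gradient, is the axis of a cone in
  \<open>\<Omega>\<close>, and the opposite ray starts outside \<open>\<Omega>\<close>.\<close>

lemma C1_boundary_cones:
  assumes \<Omega>: "open \<Omega>" "C1_boundary \<Omega>" and \<zeta>: "\<zeta> \<in> frontier \<Omega>"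
  obtains u r0 where "cmod u = 1" "0 < r0"
    "\<And>s. 0 < s \<Longrightarrow> s < r0 \<Longrightarrow> ball (\<zeta> + of_real s * u) (1/4 * s) \<subseteq> \<Omega>"
    "\<And>s. 0 \<le> s \<Longrightarrow> s < r0 \<Longrightarrow> \<zeta> - of_real s * u \<notin> \<Omega>"
proof -
  from bspec[OF \<Omega>(2)[unfolded C1_boundary_def] \<zeta>]
  obtain U \<rho> and grad :: "complex \<Rightarrow> complex" where "open U \<and> \<zeta> \<in> U \<and>
      (\<forall>z\<in>U. (\<rho> has_derivative (\<lambda>h. grad z \<bullet> h)) (at z)) \<and>
      continuous_on U grad \<and> (\<forall>z\<in>U. grad z \<noteq> 0) \<and> \<Omega> \<inter> U = {z\<in>U. (\<rho> z :: real) < 0}"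
    by (elim exE) (rule that)
  then have U: "open U" "\<zeta> \<in> U"
    "\<And>z. z \<in> U \<Longrightarrow> (\<rho> has_derivative (\<lambda>h. grad z \<bullet> h)) (at z)"
    "\<And>z. z \<in> U \<Longrightarrow> grad z \<noteq> 0" "\<Omega> \<inter> U = {z\<in>U. (\<rho> z :: real) < 0}"
    by simp_all
  have \<Omega>_iff: "z \<in> \<Omega> \<longleftrightarrow> \<rho> z < 0" if "z \<in> U" for z
    using U(5) that by blast
  have \<zeta>': "\<zeta> \<notin> \<Omega>" "\<zeta> \<in> closure \<Omega>"
    using \<zeta> \<Omega>(1) by (auto simp: frontier_def interior_open)
  define g where "g = grad \<zeta>"
  have g: "0 < norm g" using U(2,4) by (simp add: g_def)
  have der: "(\<rho> has_derivative (\<lambda>h. g \<bullet> h)) (at \<zeta>)"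
    using U(2,3) by (simp add: g_def)
  \<comment> \<open>The boundary condition only tells where \<open>\<rho>\<close> is negative. A
    positive value at \<open>\<zeta>\<close> would by continuity keep a whole neighbourhood free of
    \<open>\<Omega>\<close>.\<close>
  have "\<rho> \<zeta> = 0"
  proof (rule antisym)
    show "0 \<le> \<rho> \<zeta>" using \<Omega>_iff[OF U(2)] \<zeta>' by simp
    show "\<rho> \<zeta> \<le> 0"
    proof (rule ccontr)
      assume "\<not> ?thesis"
      then have pos: "0 < \<rho> \<zeta>" by simp
      have "isCont \<rho> \<zeta>"
        using der has_derivative_continuous by blast
      then have "\<forall>\<^sub>F z in nhds \<zeta>. 0 < \<rho> z"
        using pos order_tendstoD(1) by (fastforce simp: isCont_def tendsto_at_iff_tendsto_nhds)
      moreover have "\<forall>\<^sub>F z in nhds \<zeta>. z \<in> U"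
        using U by (simp add: eventually_nhds_in_open)
      ultimately have "\<forall>\<^sub>F z in nhds \<zeta>. z \<notin> \<Omega>"
        by eventually_elim (simp add: \<Omega>_iff)
      then obtain S where "open S" "\<zeta> \<in> S" "\<And>z. z \<in> S \<Longrightarrow> z \<notin> \<Omega>"
        unfolding eventually_nhds by blast
      then show False
        using \<zeta>'(2) by (auto simp: closure_iff_nhds_not_empty)
    qed
  qed
  \<comment> \<open>The tolerance \<open>norm g / 8\<close> leaves room on both sides: in the inner
    balls the linear term is at most \<open>- (3/4 * (norm g * s))\<close> against an error of
    \<open>5/32 * (norm g * s)\<close>, and on the outer ray it is \<open>s * norm g\<close> against
    an eighth of that.\<close>
  have "\<exists>\<delta>>0. \<forall>y. norm (y - \<zeta>) < \<delta> \<longrightarrow> norm (\<rho> y - \<rho> \<zeta> - g \<bullet> (y - \<zeta>)) \<le> norm g / 8 * norm (y - \<zeta>)"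
    using der[unfolded has_derivative_at_alt] g by (auto dest!: spec[of _ "norm g / 8"])
  then obtain \<delta>1 where \<delta>1: "0 < \<delta>1"
    "\<And>y. cmod (y - \<zeta>) < \<delta>1 \<Longrightarrow> \<bar>\<rho> y - g \<bullet> (y - \<zeta>)\<bar> \<le> norm g / 8 * cmod (y - \<zeta>)"
    using \<open>\<rho> \<zeta> = 0\<close> by auto
  obtain \<delta>2 where \<delta>2: "0 < \<delta>2" "ball \<zeta> \<delta>2 \<subseteq> U"
    using U(1,2) open_contains_ball by blast
  define r0 where "r0 = min \<delta>1 \<delta>2 / 2"
  have r0: "0 < r0" "2 * r0 \<le> \<delta>1" "2 * r0 \<le> \<delta>2"
    using \<delta>1 \<delta>2 by (auto simp: r0_def)
  define u where "u = - (g /\<^sub>R norm g)"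
  have u: "cmod u = 1" "g \<bullet> u = - norm g"
    using g by (auto simp: u_def inner_commute power2_norm_eq_inner[symmetric] power2_eq_square)
  have inU: "y \<in> U" "cmod (y - \<zeta>) < \<delta>1" if "cmod (y - \<zeta>) < 2 * r0" for y
    using that r0 \<delta>2(2) by (auto simp: dist_norm norm_minus_commute subset_iff)
  show ?thesis
  proof
    show "cmod u = 1" "0 < r0" by fact+
    show "ball (\<zeta> + of_real s * u) (1/4 * s) \<subseteq> \<Omega>" if s: "0 < s" "s < r0" for s
    proof
      fix y assume y: "y \<in> ball (\<zeta> + of_real s * u) (1/4 * s)"
      define v where "v = y - (\<zeta> + of_real s * u)"
      have v: "cmod v < 1/4 * s"
        using y by (simp add: v_def dist_norm norm_minus_commute)
      have yv: "y - \<zeta> = s *\<^sub>R u + v"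
        by (simp add: v_def scaleR_conv_of_real)
      have y1: "cmod (y - \<zeta>) < 5/4 * s"
        unfolding yv using norm_triangle_ineq[of "s *\<^sub>R u" v] v u s by simp
      have "g \<bullet> (y - \<zeta>) = - s * norm g + g \<bullet> v"
        unfolding yv by (simp add: inner_add_right u)
      also have "\<dots> \<le> - s * norm g + norm g * (1/4 * s)"
        using norm_ge_zero[of g] Cauchy_Schwarz_ineq2[of g v] v mult_left_mono[of "cmod v" "1/4 * s" "norm g"] by linarith
      finally have 1: "g \<bullet> (y - \<zeta>) \<le> - (3/4 * (norm g * s))"
        by (simp add: algebra_simps)
      have "\<bar>\<rho> y - g \<bullet> (y - \<zeta>)\<bar> \<le> norm g / 8 * (5/4 * s)"
      proof -
        have "cmod (y - \<zeta>) < 2 * r0" using y1 s by linarith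
        then have "\<bar>\<rho> y - g \<bullet> (y - \<zeta>)\<bar> \<le> norm g / 8 * cmod (y - \<zeta>)"
          using \<delta>1(2) inU(2) by blast
        also have "\<dots> \<le> norm g / 8 * (5/4 * s)"
          using y1 by (intro mult_left_mono) auto
        finally show ?thesis .
      qed
      then have "\<rho> y \<le> 5/32 * (norm g * s) - 3/4 * (norm g * s)"
        using 1 by (simp only: abs_le_iff times_divide_eq_left times_divide_eq_right) linarith
      moreover have "0 < norm g * s" using g s by simp
      ultimately have "\<rho> y < 0" by linarith
      then show "y \<in> \<Omega>"
        using inU(1)[of y] y1 s by (simp add: \<Omega>_iff)
    qed
    show "\<zeta> - of_real s * u \<notin> \<Omega>" if s: "0 \<le> s" "s < r0" for s
    proof (cases "s = 0")
      case False
      define y where "y = \<zeta> - of_real s * u"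
      have y: "y - \<zeta> = - (s *\<^sub>R u)" by (simp add: y_def scaleR_conv_of_real)
      then have y1: "cmod (y - \<zeta>) = s" using s u by simp
      have "g \<bullet> (y - \<zeta>) = s * norm g" unfolding y by (simp add: u)
      moreover have "\<bar>\<rho> y - g \<bullet> (y - \<zeta>)\<bar> \<le> 1/8 * (s * norm g)"
        using \<delta>1(2)[of y] inU[of y] y1 s by (simp add: mult.commute)
      moreover have "0 < s * norm g" using g s False by simp
      ultimately have "0 < \<rho> y" by linarith
      then show ?thesis
        using inU(1)[of y] y1 s \<Omega>_iff[of y] by (simp add: y_def)
    qed (use \<zeta>' in simp)
  qed
qed

section \<open>Total unboundedness\<close>

text \<open>The connected set \<open>B\<close> is not exhausted by the component, so it contains a
  frontier point of the component. Such a point cannot lie in \<open>\<Omega>\<close>, since adding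
  it would give a larger connected subset of \<open>B \<inter> \<Omega>\<close>.\<close>

lemma component_closure_meets_frontier:
  fixes \<Omega> B :: "complex set"
  assumes \<Omega>: "open \<Omega>" and B: "open B" "connected B" "\<not> B \<subseteq> \<Omega>" and x: "x \<in> B \<inter> \<Omega>"
  obtains \<zeta> where "\<zeta> \<in> frontier \<Omega>" "\<zeta> \<in> B" "\<zeta> \<in> closure (connected_component_set (B \<inter> \<Omega>) x)"
proof -
  define E where "E = connected_component_set (B \<inter> \<Omega>) x"
  have E: "open E" "x \<in> E" "E \<subseteq> B \<inter> \<Omega>" "connected E"
    unfolding E_def using x
    by (auto intro!: open_connected_component open_Int \<Omega> B(1) dest: connected_component_in)
  have "B \<inter> frontier E \<noteq> {}"
    using E B x by (intro connected_Int_frontier) auto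
  then obtain \<zeta> where \<zeta>: "\<zeta> \<in> B" "\<zeta> \<in> frontier E" by blast
  have cl: "\<zeta> \<in> closure E" "\<zeta> \<notin> E"
    using \<zeta>(2) E(1) by (auto simp: frontier_def interior_open)
  have "\<zeta> \<notin> \<Omega>"
  proof
    assume "\<zeta> \<in> \<Omega>"
    have "connected (insert \<zeta> E)"
      by (rule connected_intermediate_closure[OF E(4)]) (use cl closure_subset in auto)
    then have "insert \<zeta> E \<subseteq> E"
      unfolding E_def
      by (rule connected_component_maximal[rotated]) (use E \<zeta> \<open>\<zeta> \<in> \<Omega>\<close> in \<open>auto simp: E_def\<close>)
    then show False using cl by blast
  qed
  moreover have "\<zeta> \<in> closure \<Omega>"
    using cl(1) E(3) closure_mono[of E \<Omega>] by blast
  ultimately have "\<zeta> \<in> frontier \<Omega>"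
    using \<Omega> by (simp add: frontier_def interior_open)
  then show ?thesis
    using \<zeta> cl that by (simp add: E_def)
qed

lemma SUP_norm_eq_top_iff:
  fixes g :: "complex \<Rightarrow> complex"
  shows "(SUP z\<in>E. ennreal (cmod (g z))) = top \<longleftrightarrow> \<not> bounded (g ` E)"
proof
  assume top: "(SUP z\<in>E. ennreal (cmod (g z))) = top"
  show "\<not> bounded (g ` E)"
  proof
    assume "bounded (g ` E)"
    then obtain M where "\<forall>z\<in>E. cmod (g z) \<le> M"
      by (auto simp: bounded_iff)
    then have "(SUP z\<in>E. ennreal (cmod (g z))) \<le> ennreal M"
      by (intro SUP_least) (auto intro: ennreal_leI)
    then show False using top by (simp add: top_unique)
  qed
next
  assume unb: "\<not> bounded (g ` E)"
  show "(SUP z\<in>E. ennreal (cmod (g z))) = top"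
  proof (rule ccontr)
    assume "(SUP z\<in>E. ennreal (cmod (g z))) \<noteq> top"
    then obtain M where M: "(SUP z\<in>E. ennreal (cmod (g z))) = ennreal M" "0 \<le> M"
      by (cases "SUP z\<in>E. ennreal (cmod (g z))") auto
    have "cmod (g z) \<le> M" if "z \<in> E" for z
    proof -
      have "ennreal (cmod (g z)) \<le> ennreal M"
        unfolding M(1)[symmetric] using that by (intro SUP_upper)
      then show ?thesis using M(2) by simp
    qed
    then show False using unb by (auto simp: bounded_iff)
  qed
qed

text \<open>The balls on the right are not centred on the boundary, so that their centres can be taken from
  a countable set.\<close>
lemma totally_unbounded_iff_countable:
  fixes Q :: "complex set"
  assumes \<Omega>: "open \<Omega>" and dense: "\<forall>U. open U \<longrightarrow> U \<noteq> {} \<longrightarrow> (\<exists>x\<in>Q. x \<in> U)"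
  shows "totally_unbounded g \<Omega> \<longleftrightarrow>
    (\<forall>c\<in>Q. \<forall>n. \<forall>x\<in>Q. x \<in> ball c (inverse (real (Suc n))) \<inter> \<Omega> \<longrightarrow>
      \<not> ball c (inverse (real (Suc n))) \<subseteq> \<Omega> \<longrightarrow>
      \<not> bounded (g ` connected_component_set (ball c (inverse (real (Suc n))) \<inter> \<Omega>) x))"
    (is "_ \<longleftrightarrow> ?R")
proof
  assume tu: "totally_unbounded g \<Omega>"
  show ?R
  proof (intro ballI allI impI notI)
    fix c :: complex and n :: nat and x :: complex
    let ?B = "ball c (inverse (real (Suc n)))"
    assume x: "x \<in> ?B \<inter> \<Omega>" and nsub: "\<not> ?B \<subseteq> \<Omega>"
      and bd: "bounded (g ` connected_component_set (?B \<inter> \<Omega>) x)"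
    obtain \<zeta> where \<zeta>: "\<zeta> \<in> frontier \<Omega>" "\<zeta> \<in> ?B" "\<zeta> \<in> closure (connected_component_set (?B \<inter> \<Omega>) x)"
      by (rule component_closure_meets_frontier[OF \<Omega> open_ball connected_ball nsub x])
    obtain \<delta> where \<delta>: "0 < \<delta>" "ball \<zeta> \<delta> \<subseteq> ?B"
      using \<zeta>(2) open_ball open_contains_ball by blast
    obtain y where y: "y \<in> connected_component_set (?B \<inter> \<Omega>) x" "y \<in> ball \<zeta> \<delta>"
      using \<zeta>(3) \<delta>(1) by (auto simp: closure_approachable dist_commute)
    have y\<Omega>: "y \<in> ball \<zeta> \<delta> \<inter> \<Omega>"
      using y connected_component_subset[of "?B \<inter> \<Omega>" x] by blast
    have "connected_component_set (ball \<zeta> \<delta> \<inter> \<Omega>) y \<subseteq> connected_component_set (?B \<inter> \<Omega>) y"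
      using \<delta>(2) by (intro connected_component_mono) auto
    also have "\<dots> = connected_component_set (?B \<inter> \<Omega>) x"
      using y(1) by (rule connected_component_eq)
    finally have "bounded (g ` connected_component_set (ball \<zeta> \<delta> \<inter> \<Omega>) y)"
      using bd by (meson bounded_subset image_mono)
    then show False
      using tu \<zeta>(1) \<delta>(1) y\<Omega> by (auto simp: totally_unbounded_def)
  qed
next
  assume R: ?R
  show "totally_unbounded g \<Omega>"
    unfolding totally_unbounded_def
  proof (intro ballI allI impI notI)
    fix w \<delta> x
    assume w: "w \<in> frontier \<Omega>" and \<delta>: "0 < \<delta>" and x: "x \<in> ball w \<delta> \<inter> \<Omega>"
      and bd: "bounded (g ` connected_component_set (ball w \<delta> \<inter> \<Omega>) x)"
    have "w \<notin> \<Omega>" using w \<Omega> by (simp add: frontier_def interior_open)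
    then have "\<not> ball w \<delta> \<subseteq> \<Omega>" using \<delta> centre_in_ball by blast
    then obtain \<zeta> where \<zeta>: "\<zeta> \<in> frontier \<Omega>" "\<zeta> \<in> ball w \<delta>" "\<zeta> \<in> closure (connected_component_set (ball w \<delta> \<inter> \<Omega>) x)"
      by (rule component_closure_meets_frontier[OF \<Omega> open_ball connected_ball _ x])
    obtain e where e: "0 < e" "ball \<zeta> e \<subseteq> ball w \<delta>"
      using \<zeta>(2) open_ball open_contains_ball by blast
    \<comment> \<open>A ball of radius below \<open>e / 2\<close>, centred within that radius of
      \<open>\<zeta>\<close>, contains \<open>\<zeta>\<close> and stays in
      \<open>ball \<zeta> e\<close>.\<close>
    obtain n where n: "inverse (real (Suc n)) < e / 2"
      using reals_Archimedean[of "e / 2"] e by auto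
    let ?r = "inverse (real (Suc n))"
    have r: "0 < ?r" by simp
    obtain c where c: "c \<in> Q" "c \<in> ball \<zeta> ?r"
      using dense r by (metis ball_eq_empty not_le open_ball)
    have Bsub: "ball c ?r \<subseteq> ball w \<delta>"
    proof
      fix z assume "z \<in> ball c ?r"
      then have "dist \<zeta> z < e"
        using c(2) n dist_triangle[of \<zeta> z c] by simp
      then show "z \<in> ball w \<delta>" using e(2) by auto
    qed
    have \<zeta>c: "\<zeta> \<in> ball c ?r" using c(2) by (simp add: dist_commute)
    let ?E = "connected_component_set (ball w \<delta> \<inter> \<Omega>) x"
    \<comment> \<open>As \<open>\<zeta>\<close> is in the closure of the open set \<open>?E\<close>,
      some point of \<open>Q\<close> lies in \<open>?E\<close> and in the small ball. It labels a
      component there that is contained in \<open>?E\<close>.\<close>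
    have "open (?E \<inter> ball c ?r)"
      using \<Omega> by (intro open_Int open_connected_component) auto
    moreover have "?E \<inter> ball c ?r \<noteq> {}"
      using \<zeta>(3) \<zeta>c open_ball by (metis closure_iff_nhds_not_empty inf_commute open_Int_closure_eq_empty disjoint_iff)
    ultimately obtain y where y: "y \<in> Q" "y \<in> ?E" "y \<in> ball c ?r"
      using dense by blast
    have y\<Omega>: "y \<in> \<Omega>" using y(2) connected_component_subset by blast
    have "connected_component_set (ball c ?r \<inter> \<Omega>) y \<subseteq> connected_component_set (ball w \<delta> \<inter> \<Omega>) y"
      using Bsub by (intro connected_component_mono) auto
    also have "\<dots> = ?E"
      using y(2) by (rule connected_component_eq)
    finally have "bounded (g ` connected_component_set (ball c ?r \<inter> \<Omega>) y)"
      using bd by (meson bounded_subset image_mono)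
    moreover have "\<not> ball c ?r \<subseteq> \<Omega>"
      using \<zeta>(1) \<zeta>c \<Omega> by (auto simp: frontier_def interior_open)
    ultimately show False
      using R c(1) y y\<Omega> by blast
  qed
qed

context below_space
begin

text \<open>Dense sets may have a non-dense intersection, so further conditions cannot be added
  afterwards: the functionals \<open>\<Psi>\<close> enter the same application of Baire's theorem,
  with indices in a disjoint sum.\<close>

lemma totally_unbounded_residual:
  fixes \<Psi> :: "'j \<Rightarrow> (complex \<Rightarrow> complex) \<Rightarrow> ennreal"
  assumes peak: "\<And>\<zeta>. \<zeta> \<in> frontier \<Omega> \<Longrightarrow> \<exists>h\<in>X. blows_up_at h \<Omega> \<zeta>"
    and J: "countable J"
    and lsc: "\<And>j g f C. j \<in> J \<Longrightarrow> (\<And>k::nat. g k \<in> X) \<Longrightarrow> f \<in> X \<Longrightarrow>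
        (\<And>z. z \<in> \<Omega> \<Longrightarrow> (\<lambda>k. g k z) \<longlonglongrightarrow> f z) \<Longrightarrow> (\<And>k. \<Psi> j (g k) \<le> C) \<Longrightarrow> \<Psi> j f \<le> C"
    and perturb: "\<And>j. j \<in> J \<Longrightarrow> \<exists>h\<in>X. \<forall>g\<in>X. \<forall>t. t \<noteq> 0 \<longrightarrow> \<Psi> j g = \<infinity> \<or> \<Psi> j (\<lambda>z. g z + t * h z) = \<infinity>"
  shows "ms_dense X d {g \<in> X. totally_unbounded g \<Omega> \<and> (\<forall>j\<in>J. \<Psi> j g = \<infinity>)} \<and>
    ms_gdelta X d {g \<in> X. totally_unbounded g \<Omega> \<and> (\<forall>j\<in>J. \<Psi> j g = \<infinity>)}"
proof -
  obtain Q :: "complex set" where Q: "countable Q" "\<forall>U. open U \<longrightarrow> U \<noteq> {} \<longrightarrow> (\<exists>x\<in>Q. x \<in> U)"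
    using countable_dense_exists by blast
  define B :: "complex \<times> nat \<times> complex \<Rightarrow> complex set" where
    "B = (\<lambda>(c, n, x). ball c (inverse (real (Suc n))))"
  define E where "E i = connected_component_set (B i \<inter> \<Omega>) (snd (snd i))" for i
  define I where "I = {i \<in> Q \<times> UNIV \<times> Q. snd (snd i) \<in> B i \<inter> \<Omega> \<and> \<not> B i \<subseteq> \<Omega>}"
  define \<Phi> where "\<Phi> = case_sum (\<lambda>i g. SUP z\<in>E i. ennreal (cmod (g z))) \<Psi>"
  have \<Phi>_Inl: "\<Phi> (Inl i) g = \<infinity> \<longleftrightarrow> \<not> bounded (g ` E i)" for i g
    by (simp only: \<Phi>_def sum.case SUP_norm_eq_top_iff infinity_ennreal_def)
  have \<Phi>_Inr: "\<Phi> (Inr j) = \<Psi> j" for j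
    by (simp add: \<Phi>_def)
  have tu_iff: "totally_unbounded g \<Omega> \<longleftrightarrow> (\<forall>i\<in>I. \<Phi> (Inl i) g = \<infinity>)" for g
    unfolding totally_unbounded_iff_countable[OF open_\<Omega> Q(2)] \<Phi>_Inl
    by (auto simp: I_def E_def B_def)
  have set_eq: "{g \<in> X. totally_unbounded g \<Omega> \<and> (\<forall>j\<in>J. \<Psi> j g = \<infinity>)}
      = {g \<in> X. \<forall>i \<in> I <+> J. \<Phi> i g = \<infinity>}"
    unfolding tu_iff by (auto simp: Plus_def ball_Un \<Phi>_Inr)
  have cnt: "countable (I <+> J)"
  proof -
    have "countable (Q \<times> (UNIV :: nat set) \<times> Q)"
      using Q(1) by auto
    then have "countable I"
      by (rule countable_subset[rotated]) (auto simp: I_def)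
    then show ?thesis using J by (simp add: Plus_def)
  qed
  have E_sub: "E i \<subseteq> \<Omega>" for i
    unfolding E_def using connected_component_subset by blast
  have lsc': "\<Phi> i f \<le> C" if i: "i \<in> I <+> J" and g: "\<And>k::nat. g k \<in> X" "f \<in> X"
      "\<And>z. z \<in> \<Omega> \<Longrightarrow> (\<lambda>k. g k z) \<longlonglongrightarrow> f z" "\<And>k. \<Phi> i (g k) \<le> C" for i g f C
  proof (cases i)
    case (Inl i')
    have "ennreal (cmod (f z)) \<le> C" if z: "z \<in> E i'" for z
    proof (rule LIMSEQ_le_const2)
      show "(\<lambda>k. ennreal (cmod (g k z))) \<longlonglongrightarrow> ennreal (cmod (f z))"
        using g(3) z E_sub[of i'] by (intro tendsto_ennrealI tendsto_norm) auto
      have "ennreal (cmod (g k z)) \<le> C" for k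
        using g(4)[of k] z unfolding Inl \<Phi>_def by (auto simp: SUP_le_iff)
      then show "\<exists>N. \<forall>k\<ge>N. ennreal (cmod (g k z)) \<le> C" by blast
    qed
    then show ?thesis unfolding Inl \<Phi>_def by (auto simp: SUP_le_iff)
  next
    case (Inr j)
    then show ?thesis using i lsc[of j g f C] g by (auto simp: \<Phi>_def)
  qed
  have perturb': "\<exists>h\<in>X. \<forall>g\<in>X. \<forall>t. t \<noteq> 0 \<longrightarrow> \<Phi> i g = \<infinity> \<or> \<Phi> i (\<lambda>z. g z + t * h z) = \<infinity>"
    if i: "i \<in> I <+> J" for i
  proof (cases i)
    case (Inl i')
    then have i': "snd (snd i') \<in> B i' \<inter> \<Omega>" "\<not> B i' \<subseteq> \<Omega>"
      using i by (auto simp: I_def)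
    have "open (B i')" "connected (B i')"
      by (auto simp: B_def split: prod.split)
    then obtain \<zeta> where \<zeta>: "\<zeta> \<in> frontier \<Omega>" "\<zeta> \<in> closure (E i')"
      using component_closure_meets_frontier[OF open_\<Omega> _ _ i'(2,1)] unfolding E_def by metis
    obtain h where h: "h \<in> X" "blows_up_at h \<Omega> \<zeta>"
      using peak[OF \<zeta>(1)] by blast
    \<comment> \<open>If \<open>g\<close> and \<open>g + t * h\<close> were both bounded on the
      component, so would be their difference \<open>t * h\<close>, although \<open>h\<close> blows
      up at a point of its closure.\<close>
    have "\<not> bounded (g ` E i') \<or> \<not> bounded ((\<lambda>z. g z + t * h z) ` E i')" if "g \<in> X" "t \<noteq> 0" for g t
    proof (rule ccontr)
      assume "\<not> ?thesis"
      then obtain M1 M2 where M: "\<And>z. z \<in> E i' \<Longrightarrow> cmod (g z) \<le> M1" "\<And>z. z \<in> E i' \<Longrightarrow> cmod (g z + t * h z) \<le> M2"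
        by (auto simp: bounded_iff)
      obtain e where e: "0 < e" "\<And>z. z \<in> \<Omega> \<inter> ball \<zeta> e \<Longrightarrow> (M1 + M2) / cmod t < cmod (h z)"
        using h(2) unfolding blows_up_at_def by metis
      obtain z where z: "z \<in> E i'" "z \<in> ball \<zeta> e"
        using \<zeta>(2) e(1) by (auto simp: closure_approachable dist_commute)
      have "cmod (t * h z) \<le> M2 + M1"
        using norm_triangle_ineq4[of "g z + t * h z" "g z"] M(1)[OF z(1)] M(2)[OF z(1)] by simp
      moreover have "M1 + M2 < cmod (t * h z)"
        using e(2)[of z] z E_sub[of i'] that(2) by (auto simp: norm_mult divide_less_eq mult.commute)
      ultimately show False by linarith
    qed
    then show ?thesis
      using h(1) unfolding Inl \<Phi>_Inl by blast
  next
    case (Inr j)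
    then show ?thesis using i perturb[of j] by (auto simp: \<Phi>_def)
  qed
  show ?thesis
    unfolding set_eq by (rule conjI; rule residual[OF cnt]; fact lsc' perturb')
qed

lemma totally_unbounded_residual_if_peaks:
  assumes "\<And>\<zeta>. \<zeta> \<in> frontier \<Omega> \<Longrightarrow> \<exists>h\<in>X. blows_up_at h \<Omega> \<zeta>"
  shows "ms_dense X d {g \<in> X. totally_unbounded g \<Omega>} \<and> ms_gdelta X d {g \<in> X. totally_unbounded g \<Omega>}"
  using totally_unbounded_residual[OF assms, of "{}::nat set"] by simp

text \<open>Countably many balls meeting the frontier suffice because the integral is monotone in
  the domain: each contains a ball around a frontier point, and every ball around a frontier point
  contains one of them. The peaks must be non-integrable at every scale, as the first of these
  inclusions gives no control of the radius.\<close>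

lemma nonintegrable_residual_if_peaks:
  assumes q: "q = ereal r" "1 < r"
    and peak: "\<And>\<zeta>. \<zeta> \<in> frontier \<Omega> \<Longrightarrow> \<exists>h\<in>X. blows_up_at h \<Omega> \<zeta> \<and> (\<forall>e>0. lp_integral r (ball \<zeta> e \<inter> \<Omega>) h = \<infinity>)"
  shows "ms_dense X d {g \<in> X. totally_unbounded g \<Omega> \<and> (\<forall>\<zeta>\<in>frontier \<Omega>. \<forall>\<epsilon>>0. g \<notin> OLp q (ball \<zeta> \<epsilon> \<inter> \<Omega>))} \<and>
    ms_gdelta X d {g \<in> X. totally_unbounded g \<Omega> \<and> (\<forall>\<zeta>\<in>frontier \<Omega>. \<forall>\<epsilon>>0. g \<notin> OLp q (ball \<zeta> \<epsilon> \<inter> \<Omega>))}"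
proof -
  obtain Q :: "complex set" where Q: "countable Q" "\<forall>U. open U \<longrightarrow> U \<noteq> {} \<longrightarrow> (\<exists>x\<in>Q. x \<in> U)"
    using countable_dense_exists by blast
  define B :: "complex \<times> nat \<Rightarrow> complex set" where
    "B = (\<lambda>(c, n). ball c (inverse (real (Suc n))))"
  define J where "J = {j \<in> Q \<times> UNIV. B j \<inter> frontier \<Omega> \<noteq> {}}"
  define \<Psi> where "\<Psi> j g = lp_integral r (B j \<inter> \<Omega>) g" for j g
  have B_open: "open (B j)" for j
    by (auto simp: B_def split: prod.split)
  have sets: "B j \<inter> \<Omega> \<in> sets borel" for j
    using B_open open_\<Omega> by (intro borel_open open_Int)
  have J_cnt: "countable J"
  proof -
    have "countable (Q \<times> (UNIV :: nat set))" using Q(1) by auto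
    then show ?thesis by (rule countable_subset[rotated]) (auto simp: J_def)
  qed
  have OLp_iff: "(\<forall>\<zeta>\<in>frontier \<Omega>. \<forall>\<epsilon>>0. g \<notin> OLp q (ball \<zeta> \<epsilon> \<inter> \<Omega>)) \<longleftrightarrow> (\<forall>j\<in>J. \<Psi> j g = \<infinity>)" if g: "g \<in> X" for g
  proof -
    have notin: "g \<notin> OLp q D \<longleftrightarrow> lp_integral r D g = \<infinity>" if "D \<subseteq> \<Omega>" for D
      using holomorphic_on_subset[OF X_holomorphic[OF g] that]
      by (cases "lp_integral r D g = top") (auto simp: OLp_def q less_top)
    show ?thesis
    proof
      assume L: "\<forall>\<zeta>\<in>frontier \<Omega>. \<forall>\<epsilon>>0. g \<notin> OLp q (ball \<zeta> \<epsilon> \<inter> \<Omega>)"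
      show "\<forall>j\<in>J. \<Psi> j g = \<infinity>"
      proof
        fix j assume "j \<in> J"
        then obtain \<zeta> where \<zeta>: "\<zeta> \<in> B j" "\<zeta> \<in> frontier \<Omega>" by (auto simp: J_def)
        then obtain e where e: "0 < e" "ball \<zeta> e \<subseteq> B j"
          using B_open open_contains_ball by blast
        have "lp_integral r (ball \<zeta> e \<inter> \<Omega>) g \<le> \<Psi> j g"
          unfolding \<Psi>_def using e(2) by (intro lp_integral_mono) auto
        moreover have "lp_integral r (ball \<zeta> e \<inter> \<Omega>) g = \<infinity>"
          using L \<zeta>(2) e(1) notin by blast
        ultimately show "\<Psi> j g = \<infinity>" by (simp add: top_unique)
      qed
    next
      assume R: "\<forall>j\<in>J. \<Psi> j g = \<infinity>"
      show "\<forall>\<zeta>\<in>frontier \<Omega>. \<forall>\<epsilon>>0. g \<notin> OLp q (ball \<zeta> \<epsilon> \<inter> \<Omega>)"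
      proof (intro ballI allI impI)
        fix \<zeta> and \<epsilon> :: real assume \<zeta>: "\<zeta> \<in> frontier \<Omega>" and \<epsilon>: "0 < \<epsilon>"
        obtain n where n: "inverse (real (Suc n)) < \<epsilon> / 2"
          using reals_Archimedean[of "\<epsilon> / 2"] \<epsilon> by auto
        let ?r = "inverse (real (Suc n))"
        have "0 < ?r" by simp
        then obtain c where c: "c \<in> Q" "c \<in> ball \<zeta> ?r"
          using Q(2) by (metis ball_eq_empty not_le open_ball)
        have sub: "ball c ?r \<subseteq> ball \<zeta> \<epsilon>"
        proof
          fix z assume "z \<in> ball c ?r"
          then show "z \<in> ball \<zeta> \<epsilon>"
            using c(2) n dist_triangle[of \<zeta> z c] by simp
        qed
        have "\<zeta> \<in> B (c, n)"
          using c(2) by (simp add: B_def dist_commute)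
        then have "(c, n) \<in> J"
          using c(1) \<zeta> by (auto simp: J_def)
        then have "\<Psi> (c, n) g = \<infinity>" using R by blast
        moreover have "\<Psi> (c, n) g \<le> lp_integral r (ball \<zeta> \<epsilon> \<inter> \<Omega>) g"
          unfolding \<Psi>_def using sub by (intro lp_integral_mono) (auto simp: B_def)
        ultimately show "g \<notin> OLp q (ball \<zeta> \<epsilon> \<inter> \<Omega>)"
          by (simp add: notin top_unique)
      qed
    qed
  qed
  have set_eq: "{g \<in> X. totally_unbounded g \<Omega> \<and> (\<forall>\<zeta>\<in>frontier \<Omega>. \<forall>\<epsilon>>0. g \<notin> OLp q (ball \<zeta> \<epsilon> \<inter> \<Omega>))}
     = {g \<in> X. totally_unbounded g \<Omega> \<and> (\<forall>j\<in>J. \<Psi> j g = \<infinity>)}"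
    using OLp_iff by blast
  show ?thesis
    unfolding set_eq
  proof (rule totally_unbounded_residual[OF _ J_cnt])
    show "\<exists>h\<in>X. blows_up_at h \<Omega> \<zeta>" if "\<zeta> \<in> frontier \<Omega>" for \<zeta>
      using peak[OF that] by blast
    show "\<Psi> j f \<le> C" if g: "\<And>k::nat. g k \<in> X" "\<And>z. z \<in> \<Omega> \<Longrightarrow> (\<lambda>k. g k z) \<longlonglongrightarrow> f z" "\<And>k. \<Psi> j (g k) \<le> C"
      for j g f C
      unfolding \<Psi>_def
      by (rule lp_integral_lower_semicontinuous[of g]) (use g q sets X_measurable in \<open>auto simp: \<Psi>_def\<close>)
    show "\<exists>h\<in>X. \<forall>g\<in>X. \<forall>t. t \<noteq> 0 \<longrightarrow> \<Psi> j g = \<infinity> \<or> \<Psi> j (\<lambda>z. g z + t * h z) = \<infinity>" if j: "j \<in> J" for j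
    proof -
      obtain \<zeta> where \<zeta>: "\<zeta> \<in> B j" "\<zeta> \<in> frontier \<Omega>" using j by (auto simp: J_def)
      then obtain e where e: "0 < e" "ball \<zeta> e \<subseteq> B j"
        using B_open open_contains_ball by blast
      obtain h where h: "h \<in> X" "lp_integral r (ball \<zeta> e \<inter> \<Omega>) h = \<infinity>"
        using peak[OF \<zeta>(2)] e(1) by blast
      have "lp_integral r (ball \<zeta> e \<inter> \<Omega>) h \<le> \<Psi> j h"
        unfolding \<Psi>_def using e(2) by (intro lp_integral_mono) auto
      then have hinf: "\<Psi> j h = top" using h(2) by (simp add: top_unique)
      have "\<Psi> j g = top \<or> \<Psi> j (\<lambda>z. g z + t * h z) = top" if g: "g \<in> X" and t: "t \<noteq> 0" for g t
      proof (rule ccontr)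
        assume "\<not> ?thesis"
        then have fin: "\<Psi> j g < top" "\<Psi> j (\<lambda>z. g z + t * h z) < top"
          by (auto simp: less_top)
        note meas = X_measurable[OF g] X_measurable[OF X_add_scale[OF g h(1)]]
        have "\<Psi> j (\<lambda>z. (-1) * g z) < top"
          unfolding \<Psi>_def lp_integral_scale[OF meas(1) sets] using fin(1) by (simp add: \<Psi>_def)
        \<comment> \<open>Functions with finite integral form a linear space, so
          \<open>t * h\<close>, the difference of two of them, would be one too.\<close>
        then have "\<Psi> j (\<lambda>z. (g z + t * h z) + (-1) * g z) < top"
          using fin(2) meas q sets unfolding \<Psi>_def
          by - (rule lp_integral_add_finite, auto simp: \<Psi>_def)
        then have "\<Psi> j (\<lambda>z. t * h z) < top" by simp
        then have "ennreal (cmod t powr r) * \<Psi> j h < top"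
          unfolding \<Psi>_def using X_measurable[OF h(1)] sets by (simp add: lp_integral_scale)
        then show False
          using hinf t by (simp add: ennreal_mult_top)
      qed
      then show ?thesis using h(1) by auto
    qed
  qed
qed

end

section \<open>Consequences of the outer ray and the inner cone at a boundary point\<close>

lemma outer_segment:
  fixes u \<zeta> :: complex
  assumes u: "cmod u = 1" and r0: "0 < r0"
    and outer: "\<And>s. 0 \<le> s \<Longrightarrow> s < r0 \<Longrightarrow> \<zeta> - of_real s * u \<notin> \<Omega>"
  obtains a where "a \<noteq> \<zeta>" "closed_segment \<zeta> a \<inter> \<Omega> = {}"
proof
  define a where "a = \<zeta> - of_real (r0 / 2) * u"
  show "a \<noteq> \<zeta>"
    using u r0 by (auto simp: a_def)
  have "z \<notin> \<Omega>" if z: "z \<in> closed_segment \<zeta> a" for z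
  proof -
    obtain t where t: "0 \<le> t" "t \<le> 1" "z = (1 - t) *\<^sub>R \<zeta> + t *\<^sub>R a"
      using z by (auto simp: in_segment)
    then have "z = \<zeta> - of_real (t * r0 / 2) * u"
      by (simp add: a_def scaleR_conv_of_real algebra_simps)
    moreover have "t * r0 \<le> 1 * r0"
      using t r0 by (intro mult_right_mono) auto
    ultimately show ?thesis
      using outer[of "t * r0 / 2"] t r0 by simp
  qed
  then show "closed_segment \<zeta> a \<inter> \<Omega> = {}" by blast
qed

lemma lp_integral_infinite_on_cone:
  assumes u: "cmod u = 1" and r0: "0 < r0"
    and inner: "\<And>s. 0 < s \<Longrightarrow> s < r0 \<Longrightarrow> ball (\<zeta> + of_real s * u) (1/4 * s) \<subseteq> \<Omega>"
    and c: "0 < c" and e: "0 < e"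
    and lower: "\<And>z. z \<in> \<Omega> \<inter> ball \<zeta> e \<Longrightarrow> c * cmod (z - \<zeta>) powr - 2 \<le> cmod (h z) powr r"
    and \<epsilon>: "0 < \<epsilon>"
  shows "lp_integral r (ball \<zeta> \<epsilon> \<inter> \<Omega>) h = \<infinity>"
proof -
  define \<delta> where "\<delta> = min e \<epsilon>"
  have \<delta>: "0 < \<delta>" "\<delta> \<le> e" "\<delta> \<le> \<epsilon>" using e \<epsilon> by (auto simp: \<delta>_def)
  \<comment> \<open>Truncating the cone at height \<open>\<delta> / 2\<close> keeps it in
    \<open>ball \<zeta> \<delta>\<close>: points of the ball at height \<open>s\<close> have
    distance less than \<open>5/4 * s\<close> from \<open>\<zeta>\<close>.\<close>
  have inf: "(\<integral>\<^sup>+z. ennreal (cmod (z - \<zeta>) powr - 2) * indicator (\<Union>s\<in>{0<..<min r0 (\<delta> / 2)}. ball (\<zeta> + of_real s * u) (1/4 * s)) z \<partial>lborel) = \<infinity>"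
    by (rule nn_integral_norm_powr_cone_infinite[OF u, of "1/4" "min r0 (\<delta> / 2)"]) (use r0 \<delta> in auto)
  let ?K = "\<Union>s\<in>{0<..<min r0 (\<delta> / 2)}. ball (\<zeta> + of_real s * u) (1/4 * s)"
  have K: "z \<in> \<Omega>" "z \<in> ball \<zeta> \<delta>" if z: "z \<in> ?K" for z
  proof -
    obtain s where s: "0 < s" "s < r0" "s < \<delta> / 2" "z \<in> ball (\<zeta> + of_real s * u) (1/4 * s)"
      using z by auto
    then show "z \<in> \<Omega>" using inner by blast
    have "dist \<zeta> (\<zeta> + of_real s * u) = s"
      using u s by (simp add: dist_norm norm_mult)
    then show "z \<in> ball \<zeta> \<delta>"
      using s dist_triangle[of \<zeta> z "\<zeta> + of_real s * u"] by simp
  qed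
  have "open ?K" by blast
  then have [measurable]: "?K \<in> sets borel" by simp
  have "ennreal c * (\<integral>\<^sup>+z. ennreal (cmod (z - \<zeta>) powr - 2) * indicator ?K z \<partial>lborel)
      = (\<integral>\<^sup>+z. ennreal c * (ennreal (cmod (z - \<zeta>) powr - 2) * indicator ?K z) \<partial>lborel)"
    by (rule nn_integral_cmult[symmetric]) measurable
  also have "\<dots> \<le> lp_integral r (ball \<zeta> \<epsilon> \<inter> \<Omega>) h"
    unfolding lp_integral_def
  proof (intro nn_integral_mono)
    fix z
    show "ennreal c * (ennreal (cmod (z - \<zeta>) powr - 2) * indicator ?K z)
        \<le> ennreal (cmod (h z) powr r) * indicator (ball \<zeta> \<epsilon> \<inter> \<Omega>) z"
    proof (cases "z \<in> ?K")
      case True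
      have "z \<in> ball \<zeta> e" "z \<in> ball \<zeta> \<epsilon>" using K(2)[OF True] \<delta> by auto
      moreover have "ennreal c * ennreal (cmod (z - \<zeta>) powr - 2) \<le> ennreal (cmod (h z) powr r)"
        using lower[of z] K(1)[OF True] \<open>z \<in> ball \<zeta> e\<close> c by (simp add: ennreal_leI flip: ennreal_mult)
      ultimately show ?thesis
        using True K(1)[OF True] by (simp only: indicator_simps Int_iff mult_1_right simp_thms)
    next
      case False
      then have "indicator ?K z = (0 :: ennreal)"
        by (rule indicator_simps(2))
      then show ?thesis
        by (simp only: mult_zero_right zero_le)
    qed
  qed
  finally show ?thesis
    unfolding inf using c by (simp add: ennreal_mult_top top_unique)
qed

theorem theorem10:
  shows
   "(\<forall>(\<Omega>::complex set) p. open \<Omega> \<and> bounded \<Omega> \<and> admissible_seq 2 p \<longrightarrow>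
       (let X = OLbelow 2 \<Omega>; A = {g\<in>X. totally_unbounded g \<Omega>} in
          ms_dense X (OLdist \<Omega> p) A \<and> ms_gdelta X (OLdist \<Omega> p) A))
  \<and> (\<forall>(\<Omega>::complex set) (q::real) p. open \<Omega> \<and> bounded \<Omega> \<and>
       (\<forall>\<zeta>\<in>frontier \<Omega>. connected_component_set (- \<Omega>) \<zeta> - {\<zeta>} \<noteq> {}) \<and>
       1 < q \<and> admissible_seq (ereal q) p \<longrightarrow>
       (let X = OLbelow (ereal q) \<Omega>; A = {g\<in>X. totally_unbounded g \<Omega>} in
          ms_dense X (OLdist \<Omega> p) A \<and> ms_gdelta X (OLdist \<Omega> p) A))
  \<and> (\<forall>(\<Omega>::complex set) (q::ereal) p. open \<Omega> \<and> bounded \<Omega> \<and> C1_boundary \<Omega> \<and>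
       1 < q \<and> admissible_seq q p \<longrightarrow>
       (let X = OLbelow q \<Omega>;
            A = {g\<in>X. totally_unbounded g \<Omega> \<and>
                 (\<forall>\<zeta>\<in>frontier \<Omega>. \<forall>\<epsilon>>0. g \<notin> OLp q (ball \<zeta> \<epsilon> \<inter> \<Omega>))} in
          ms_dense X (OLdist \<Omega> p) A \<and> ms_gdelta X (OLdist \<Omega> p) A))"
proof (intro conjI allI impI; elim conjE)
  fix \<Omega> :: "complex set" and p
  assume \<Omega>: "open \<Omega>" "bounded \<Omega>" and p: "admissible_seq 2 p"
  interpret below_space \<Omega> 2 p
    by standard (fact \<Omega> p)+
  have "\<zeta> \<notin> \<Omega>" if "\<zeta> \<in> frontier \<Omega>" for \<zeta>
    using that \<Omega>(1) by (simp add: frontier_def interior_open)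
  then show "let X = OLbelow 2 \<Omega>; A = {g\<in>X. totally_unbounded g \<Omega>} in
      ms_dense X (OLdist \<Omega> p) A \<and> ms_gdelta X (OLdist \<Omega> p) A"
    unfolding Let_def by (intro totally_unbounded_residual_if_peaks pole_in_OLbelow[OF \<Omega>])
next
  fix \<Omega> :: "complex set" and q :: real and p
  assume \<Omega>: "open \<Omega>" "bounded \<Omega>" and q: "1 < q" and p: "admissible_seq (ereal q) p"
    and comp: "\<forall>\<zeta>\<in>frontier \<Omega>. connected_component_set (- \<Omega>) \<zeta> - {\<zeta>} \<noteq> {}"
  interpret below_space \<Omega> "ereal q" p
    by standard (fact \<Omega> p)+
  have "\<exists>h\<in>OLbelow (ereal q) \<Omega>. blows_up_at h \<Omega> \<zeta>" if \<zeta>: "\<zeta> \<in> frontier \<Omega>" for \<zeta>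
  proof -
    let ?C = "connected_component_set (- \<Omega>) \<zeta>"
    obtain a where a: "a \<in> ?C" "a \<noteq> \<zeta>"
      using comp \<zeta> by blast
    have "\<zeta> \<in> ?C"
      using \<zeta> \<Omega>(1) by (simp add: frontier_def interior_open)
    moreover have "?C \<inter> \<Omega> = {}"
      using connected_component_subset[of "- \<Omega>" \<zeta>] by blast
    ultimately show ?thesis
      using power_peak_in_OLbelow[OF \<Omega> connected_connected_component _ a(1) _ a(2) q] by metis
  qed
  then show "let X = OLbelow (ereal q) \<Omega>; A = {g\<in>X. totally_unbounded g \<Omega>} in
      ms_dense X (OLdist \<Omega> p) A \<and> ms_gdelta X (OLdist \<Omega> p) A"
    unfolding Let_def by (intro totally_unbounded_residual_if_peaks)
next
  fix \<Omega> :: "complex set" and q :: ereal and p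
  assume \<Omega>: "open \<Omega>" "bounded \<Omega>" and C1: "C1_boundary \<Omega>" and q: "1 < q" and p: "admissible_seq q p"
  interpret below_space \<Omega> q p
    by standard (fact \<Omega> p)+
  show "let X = OLbelow q \<Omega>; A = {g\<in>X. totally_unbounded g \<Omega> \<and>
        (\<forall>\<zeta>\<in>frontier \<Omega>. \<forall>\<epsilon>>0. g \<notin> OLp q (ball \<zeta> \<epsilon> \<inter> \<Omega>))} in
      ms_dense X (OLdist \<Omega> p) A \<and> ms_gdelta X (OLdist \<Omega> p) A"
  proof (cases q)
    case (real r)
    then have r: "1 < r" using q by simp
    have "\<exists>h\<in>X. blows_up_at h \<Omega> \<zeta> \<and> (\<forall>\<epsilon>>0. lp_integral r (ball \<zeta> \<epsilon> \<inter> \<Omega>) h = \<infinity>)"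
      if \<zeta>: "\<zeta> \<in> frontier \<Omega>" for \<zeta>
    proof -
      obtain u r0 where u: "cmod u = 1" and r0: "0 < r0"
        and inner: "\<And>s. 0 < s \<Longrightarrow> s < r0 \<Longrightarrow> ball (\<zeta> + of_real s * u) (1/4 * s) \<subseteq> \<Omega>"
        and outer: "\<And>s. 0 \<le> s \<Longrightarrow> s < r0 \<Longrightarrow> \<zeta> - of_real s * u \<notin> \<Omega>"
        using C1_boundary_cones[OF \<Omega>(1) C1 \<zeta>] by metis
      obtain a where a: "a \<noteq> \<zeta>" "closed_segment \<zeta> a \<inter> \<Omega> = {}"
        using outer_segment[OF u r0 outer] by metis
      obtain h c e where h: "h \<in> OLbelow (ereal r) \<Omega>" "blows_up_at h \<Omega> \<zeta>" "0 < c" "0 < e"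
        "\<And>z. z \<in> \<Omega> \<inter> ball \<zeta> e \<Longrightarrow> c * cmod (z - \<zeta>) powr - 2 \<le> cmod (h z) powr r"
        using power_peak_in_OLbelow[OF \<Omega> connected_segment(1) _ _ a(2) a(1) r] by (metis ends_in_segment)
      have "lp_integral r (ball \<zeta> \<epsilon> \<inter> \<Omega>) h = \<infinity>" if \<epsilon>: "0 < \<epsilon>" for \<epsilon>
        by (rule lp_integral_infinite_on_cone[OF u r0 inner h(3-5) \<epsilon>])
      then show ?thesis using h real by blast
    qed
    then show ?thesis
      unfolding Let_def by (intro nonintegrable_residual_if_peaks[OF real r])
  next
    case PInf
    have "\<exists>h\<in>X. blows_up_at h \<Omega> \<zeta>" if \<zeta>: "\<zeta> \<in> frontier \<Omega>" for \<zeta>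
    proof -
      obtain u r0 where u: "cmod u = 1" and r0: "0 < r0"
        and outer: "\<And>s. 0 \<le> s \<Longrightarrow> s < r0 \<Longrightarrow> \<zeta> - of_real s * u \<notin> \<Omega>"
        using C1_boundary_cones[OF \<Omega>(1) C1 \<zeta>] by metis
      obtain a where "a \<noteq> \<zeta>" "closed_segment \<zeta> a \<inter> \<Omega> = {}"
        using outer_segment[OF u r0 outer] by metis
      then show ?thesis
        unfolding PInf by (intro log_peak_in_OLbelow[OF \<Omega>])
    qed
    note residual = totally_unbounded_residual_if_peaks[OF this]
    \<comment> \<open>For infinite \<open>q\<close> the second condition follows from the first:
      near a boundary point there is at least one component, and \<open>g\<close> is already
      unbounded on it.\<close>
    have "g \<notin> OLp q (ball \<zeta> \<epsilon> \<inter> \<Omega>)" if g: "totally_unbounded g \<Omega>" and \<zeta>: "\<zeta> \<in> frontier \<Omega>" and \<epsilon>: "0 < \<epsilon>" for g \<zeta> \<epsilon>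
    proof -
      have "\<zeta> \<in> closure \<Omega>" using \<zeta> by (simp add: frontier_def)
      then obtain x where x: "x \<in> ball \<zeta> \<epsilon> \<inter> \<Omega>"
        using \<epsilon> by (auto simp: closure_approachable dist_commute)
      then have "\<not> bounded (g ` connected_component_set (ball \<zeta> \<epsilon> \<inter> \<Omega>) x)"
        using g \<zeta> \<epsilon> by (auto simp: totally_unbounded_def)
      then have "\<not> bounded (g ` (ball \<zeta> \<epsilon> \<inter> \<Omega>))"
        by (meson bounded_subset connected_component_subset image_mono)
      then show ?thesis by (simp add: OLp_def PInf)
    qed
    then have "{g\<in>X. totally_unbounded g \<Omega> \<and> (\<forall>\<zeta>\<in>frontier \<Omega>. \<forall>\<epsilon>>0. g \<notin> OLp q (ball \<zeta> \<epsilon> \<inter> \<Omega>))}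
        = {g\<in>X. totally_unbounded g \<Omega>}"
      by blast
    then show ?thesis
      unfolding Let_def using residual by simp
  qed (use q in simp)
qed

end
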